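(* Let $J$ be a Hahn--Banach smooth Banach space. Suppose that $J \subset X$ is an $M$-ideal in a Banach space $X$ and that the quotient space $X/J$ does not have any smooth points. Then every smooth point of $X$ is a very smooth point of $X$.
   Context: A unit vector $x$ of a Banach space $X$ is a smooth point of $X$ if there is exactly one $x^* \in X^*$ with $\|x^*\| = 1 = x^*(x)$. A unit vector $x \in X$ is a very smooth point of $X$ if, regarded as an element of $X^{**}$ under the canonical embedding $X \subset X^{**}$, it is a smooth point of $X^{**}$. A closed subspace $J \subset X$ is an $M$-ideal in $X$ if there is a linear projection $P : X^* \to X^*$ with $\|P(x^* )\| + \|x^* - P(x^* )\| = \|x^*\|$ for all $x^* \in X^*$ and $\ker P = J^\perp$. A Banach space $J$ is Hahn--Banach smooth if every continuous linear functional on $J$ has a unique norm preserving extension to $J^{**}$ (where $J \subset J^{**}$ canonically). *)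

theory Defs
  imports "HOL-Analysis.Analysis" "HOL-Algebra.AbelCoset" "HOL-Algebra.Module"
begin

text \<open>
  Subspaces, quotients, duals and biduals of an arbitrary Banach space are needed side by side,
  so normed spaces are modelled with explicit carriers, on top of the modules of HOL-Algebra.
\<close>

subsection \<open>The scalar field\<close>

text \<open>
  A normed field that contains the reals and embeds isometrically into the complex numbers is
  either a copy of the reals or a copy of the complex numbers.
\<close>

class real_or_complex = real_normed_field +
  assumes isometric_embedding_into_complex:
    "\<exists>h :: 'a \<Rightarrow> complex.
       h 1 = 1 \<and> (\<forall>r a. h (r *\<^sub>R a) = r *\<^sub>R h a) \<and>
       (\<forall>a b. h (a + b) = h a + h b) \<and> (\<forall>a b. h (a * b) = h a * h b) \<and>
       (\<forall>a. norm (h a) = norm a)"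

instance real :: real_or_complex
  by standard (intro exI[of _ complex_of_real] conjI allI; simp add: scaleR_conv_of_real)

instance complex :: real_or_complex
  by standard (intro exI[of _ id] conjI allI; simp)


subsection \<open>Normed spaces and Banach spaces\<close>

text \<open>
  The fields \<open>mult\<close> and \<open>one\<close>, which modules inherit from rings, matter only for the scalar field below.
\<close>

record ('k, 'v) normed_module = "('k, 'v) module" +
  vnorm :: "'v \<Rightarrow> real"

text \<open>The scalar field, both as a ring of scalars and as a one-dimensional normed space.\<close>

definition scalars :: "('k::real_or_complex, 'k) normed_module" where
  "scalars = \<lparr>carrier = UNIV, mult = (*), one = 1, zero = 0, add = (+), smult = (*), vnorm = norm\<rparr>"

definition vdist :: "('k, 'v, 'm) normed_module_scheme \<Rightarrow> 'v \<Rightarrow> 'v \<Rightarrow> real" where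
  "vdist V x y = vnorm V (x \<ominus>\<^bsub>V\<^esub> y)"

locale normed_space = module "scalars :: ('k, 'k) normed_module" V
  for V :: "('k::real_or_complex, 'v, 'm) normed_module_scheme" (structure) +
  assumes vnorm_eq_0_iff: "x \<in> carrier V \<Longrightarrow> vnorm V x = 0 \<longleftrightarrow> x = \<zero>"
    and vnorm_smult: "x \<in> carrier V \<Longrightarrow> vnorm V (c \<odot> x) = norm c * vnorm V x"
    and vnorm_triangle:
      "x \<in> carrier V \<Longrightarrow> y \<in> carrier V \<Longrightarrow> vnorm V (x \<oplus> y) \<le> vnorm V x + vnorm V y"

locale banach_space = normed_space +
  assumes complete: "Metric_space.mcomplete (carrier V) (vdist V)"

definition closed_subspace ::
    "'v set \<Rightarrow> ('k::real_or_complex, 'v, 'm) normed_module_scheme \<Rightarrow> bool" where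
  "closed_subspace J V \<longleftrightarrow>
     submodule J (scalars :: ('k, 'k) normed_module) V \<and>
     closedin (Metric_space.mtopology (carrier V) (vdist V)) J"

text \<open>
  The quotient norm of a coset is its distance from zero, that is, the infimum of the norms of
  its elements. The coset \<open>J\<close> is added in the scalar multiplication so that zero times a coset
  is \<open>J\<close> rather than the singleton of zero.
\<close>

definition quotient_space ::
    "('k, 'v, 'm) normed_module_scheme \<Rightarrow> 'v set \<Rightarrow> ('k, 'v set) normed_module" where
  "quotient_space V J =
     \<lparr>carrier = a_rcosets\<^bsub>V\<^esub> J, mult = undefined, one = undefined,
      zero = J, add = (\<lambda>A B. A <+>\<^bsub>V\<^esub> B),
      smult = (\<lambda>c A. J <+>\<^bsub>V\<^esub> ((\<lambda>x. c \<odot>\<^bsub>V\<^esub> x) ` A)),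
      vnorm = (\<lambda>A. INF x\<in>A. vnorm V x)\<rparr>"


subsection \<open>Dual spaces\<close>

definition linear_map ::
    "('k, 'v, 'm) normed_module_scheme \<Rightarrow> ('k, 'w, 'n) normed_module_scheme \<Rightarrow> ('v \<Rightarrow> 'w) \<Rightarrow> bool"
  where
  "linear_map V W f \<longleftrightarrow>
     f \<in> carrier V \<rightarrow> carrier W \<and>
     (\<forall>x\<in>carrier V. \<forall>y\<in>carrier V. f (x \<oplus>\<^bsub>V\<^esub> y) = f x \<oplus>\<^bsub>W\<^esub> f y) \<and>
     (\<forall>c. \<forall>x\<in>carrier V. f (c \<odot>\<^bsub>V\<^esub> x) = c \<odot>\<^bsub>W\<^esub> f x)"

text \<open>
  Functionals are extensional, so that two functionals are equal iff they agree on the carrier.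
\<close>

definition dual ::
    "('k::real_or_complex, 'v, 'm) normed_module_scheme \<Rightarrow> ('k, 'v \<Rightarrow> 'k) normed_module" where
  "dual V =
     \<lparr>carrier = {f \<in> extensional (carrier V). linear_map V scalars f \<and>
        (\<exists>B. \<forall>x\<in>carrier V. norm (f x) \<le> B * vnorm V x)},
      mult = undefined, one = undefined,
      zero = (\<lambda>x\<in>carrier V. 0), add = (\<lambda>f g. \<lambda>x\<in>carrier V. f x + g x),
      smult = (\<lambda>c f. \<lambda>x\<in>carrier V. c * f x),
      vnorm = (\<lambda>f. SUP x\<in>{x \<in> carrier V. vnorm V x \<le> 1}. norm (f x))\<rparr>"

definition bidual_embedding ::
    "('k::real_or_complex, 'v, 'm) normed_module_scheme \<Rightarrow> 'v \<Rightarrow> ('v \<Rightarrow> 'k) \<Rightarrow> 'k" where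
  "bidual_embedding V x = (\<lambda>f\<in>carrier (dual V). f x)"

definition annihilator ::
    "('k::real_or_complex, 'v, 'm) normed_module_scheme \<Rightarrow> 'v set \<Rightarrow> ('v \<Rightarrow> 'k) set" where
  "annihilator V J = {f \<in> carrier (dual V). \<forall>x\<in>J. f x = 0}"


subsection \<open>Smoothness and M-ideals\<close>

definition smooth_point ::
    "('k::real_or_complex, 'v, 'm) normed_module_scheme \<Rightarrow> 'v \<Rightarrow> bool" where
  "smooth_point V x \<longleftrightarrow>
     x \<in> carrier V \<and> vnorm V x = 1 \<and>
     (\<exists>!f. f \<in> carrier (dual V) \<and> vnorm (dual V) f = 1 \<and> f x = 1)"

definition very_smooth_point ::
    "('k::real_or_complex, 'v, 'm) normed_module_scheme \<Rightarrow> 'v \<Rightarrow> bool" where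
  "very_smooth_point V x \<longleftrightarrow>
     x \<in> carrier V \<and> vnorm V x = 1 \<and> smooth_point (dual (dual V)) (bidual_embedding V x)"

definition M_ideal ::
    "'v set \<Rightarrow> ('k::real_or_complex, 'v, 'm) normed_module_scheme \<Rightarrow> bool" where
  "M_ideal J V \<longleftrightarrow>
     closed_subspace J V \<and>
     (\<exists>P. linear_map (dual V) (dual V) P \<and>
        (\<forall>f\<in>carrier (dual V). P (P f) = P f) \<and>
        (\<forall>f\<in>carrier (dual V).
           vnorm (dual V) (P f) + vnorm (dual V) (f \<ominus>\<^bsub>dual V\<^esub> P f) = vnorm (dual V) f) \<and>
        {f \<in> carrier (dual V). P f = \<zero>\<^bsub>dual V\<^esub>} = annihilator V J)"

definition Hahn_Banach_smooth ::
    "('k::real_or_complex, 'v, 'm) normed_module_scheme \<Rightarrow> bool" where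
  "Hahn_Banach_smooth V \<longleftrightarrow>
     (\<forall>f\<in>carrier (dual V). \<exists>!F. F \<in> carrier (dual (dual (dual V))) \<and>
        vnorm (dual (dual (dual V))) F = vnorm (dual V) f \<and>
        (\<forall>x\<in>carrier V. F (bidual_embedding V x) = f x))"

end

theory Submission
  imports Defs
begin

text \<open>
  Let \<open>P\<close> be the L-projection on the dual of \<open>X\<close> whose kernel is the annihilator of \<open>J\<close>, and let \<open>f\<close> be
  the only functional supporting the smooth point \<open>x\<close>. Splitting \<open>f\<close> as \<open>P f + (f - P f)\<close> splits its
  norm, so each nonzero part supports \<open>x\<close> after normalization; by uniqueness \<open>P f = 0\<close> or \<open>P f = f\<close>
  (\<open>smooth_support_dichotomy\<close>). If \<open>P f = 0\<close>, then \<open>f\<close> annihilates \<open>J\<close>, and the coset of \<open>x\<close> is a smooth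
  point of \<open>X/J\<close> (\<open>quotient_smooth_point\<close>), which is excluded. So \<open>P f = f\<close>.

  The distance of \<open>x\<close> from \<open>J\<close> is then less than one, since otherwise a functional annihilating \<open>J\<close>
  would support \<open>x\<close> (\<open>annihilating_functional\<close>) and differ from \<open>f\<close>. The bidual of \<open>X\<close> is the maximum-norm
  sum of the bidual of \<open>J\<close>, which is the range of \<open>P\<^sup>*\<close>, and the range of \<open>I - P\<^sup>*\<close>, and the component of
  \<open>x\<close> in the second summand has norm less than one. Hence any functional \<open>F\<close> of norm one on the bidual
  with \<open>F(x) = 1\<close> vanishes on the second summand
  (\<open>bidual_support_factors_through_L_projection\<close>) and is determined by its restriction to the bidual
  of \<open>J\<close> (\<open>L_projection_factors_through_restriction\<close>). On \<open>X\<close> such an \<open>F\<close> coincides with \<open>f\<close>, so this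
  restriction extends the restriction of \<open>f\<close> to \<open>J\<close>; the extension preserves the norm because
  \<open>P f = f\<close> gives both \<open>f\<close> and its restriction to \<open>J\<close> norm one. Hahn--Banach smoothness of \<open>J\<close> leaves only
  one possibility for it, and hence for \<open>F\<close>.

  The Hahn--Banach theorem is proved for real and complex scalars at once. It rests on the fact that
  minimal sublinear functionals are linear, so that Zorn's lemma is applied to functions on the
  whole space rather than to partially defined extensions.
\<close>

section \<open>Scalars and vectors\<close>

lemma scalars_sel [simp]:
  "carrier (scalars :: ('k::real_or_complex, 'k) normed_module) = UNIV"
  "mult (scalars :: ('k, 'k) normed_module) = (*)"
  "one (scalars :: ('k, 'k) normed_module) = 1"
  "zero (scalars :: ('k, 'k) normed_module) = 0"
  "add (scalars :: ('k, 'k) normed_module) = (+)"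
  "smult (scalars :: ('k, 'k) normed_module) = (*)"
  "vnorm (scalars :: ('k, 'k) normed_module) = norm"
  by (simp_all add: scalars_def)

text \<open>
  Treats both scalar fields at once: \<open>\<iota>\<close> is the imaginary unit over the complex numbers and \<open>0\<close> over
  the reals, where the decomposition of a scalar degenerates to its real part.
\<close>

lemma scalar_real_part:
  "\<exists>(re :: 'k::real_or_complex \<Rightarrow> real) \<iota>.
    (\<forall>a b. re (a + b) = re a + re b) \<and> (\<forall>r a. re (of_real r * a) = r * re a) \<and>
    (\<forall>r. re (of_real r) = r) \<and> (\<forall>a. re a \<le> norm a) \<and>
    (\<forall>a. a = of_real (re a) - of_real (re (\<iota> * a)) * \<iota>) \<and> (\<iota> = 0 \<or> \<iota> * \<iota> = - 1)"
proof -
  obtain h :: "'k \<Rightarrow> complex" where h: "h 1 = 1" "\<And>r a. h (r *\<^sub>R a) = r *\<^sub>R h a"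
      "\<And>a b. h (a + b) = h a + h b" "\<And>a b. h (a * b) = h a * h b" "\<And>a. norm (h a) = norm a"
    using isometric_embedding_into_complex by metis
  have h_of_real: "h (of_real r) = of_real r" for r
    using h(2)[of r 1] h(1) by (simp add: of_real_def)
  have h_minus: "h (a - b) = h a - h b" for a b
    using h(3)[of "a - b" b] by simp
  have h_inj: "a = b" if "h a = h b" for a b
    using h(5)[of "a - b"] h_minus[of a b] that by simp
  define re where "re = (\<lambda>a. Re (h a))"
  have re: "re (a + b) = re a + re b" "re (of_real r * a) = r * re a" "re (of_real r) = r"
      "re a \<le> norm a" for a b r
    using complex_Re_le_cmod[of "h a"] by (auto simp: re_def h h_of_real)
  show ?thesis
  proof (cases "\<exists>c. Im (h c) \<noteq> 0")
    case True
    then obtain c where c: "Im (h c) \<noteq> 0" by blast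
    define \<iota> where "\<iota> = of_real (1 / Im (h c)) * (c - of_real (Re (h c)))"
    have h_\<iota>: "h \<iota> = \<i>"
      using c by (simp add: \<iota>_def h h_minus h_of_real complex_eq_iff del: of_real_divide)
    have "\<iota> * \<iota> = - 1"
      by (rule h_inj) (use h_minus[of 0 1] h_of_real[of 0] h(1) in \<open>simp add: h h_\<iota>\<close>)
    moreover have "a = of_real (re a) - of_real (re (\<iota> * a)) * \<iota>" for a
      by (rule h_inj) (simp add: h h_\<iota> h_minus h_of_real re_def complex_eq_iff)
    ultimately show ?thesis using re by blast
  next
    case False
    have "a = of_real (re a) - of_real (re (0 * a)) * 0" for a
      by (rule h_inj) (use False in \<open>simp add: h_of_real re_def complex_eq_iff\<close>)
    then show ?thesis using re by (metis (no_types))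
  qed
qed

locale scalar_module = module "scalars :: ('k, 'k) normed_module" V
  for V :: "('k::real_or_complex, 'v, 'm) normed_module_scheme" (structure)
begin

lemma smult_carrier [simp, intro]: "x \<in> carrier V \<Longrightarrow> c \<odot> x \<in> carrier V"
  using smult_closed by simp

lemma smult_add_left: "x \<in> carrier V \<Longrightarrow> (a + b) \<odot> x = a \<odot> x \<oplus> b \<odot> x"
  using smult_l_distr[of a b x] by simp

lemma smult_add_right:
  "x \<in> carrier V \<Longrightarrow> y \<in> carrier V \<Longrightarrow> a \<odot> (x \<oplus> y) = a \<odot> x \<oplus> a \<odot> y"
  using smult_r_distr[of a x y] by simp

lemma smult_smult: "x \<in> carrier V \<Longrightarrow> a \<odot> (b \<odot> x) = (a * b) \<odot> x"
  using smult_assoc1[of a b x] by simp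

lemma smult_1 [simp]: "x \<in> carrier V \<Longrightarrow> 1 \<odot> x = x"
  using smult_one[of x] by simp

lemma smult_0 [simp]: "x \<in> carrier V \<Longrightarrow> 0 \<odot> x = \<zero>"
  using smult_l_null[of x] by simp

lemma smult_zero [simp]: "c \<odot> \<zero> = \<zero>"
  using smult_r_null[of c] by simp

lemma add_uminus: "x \<in> carrier V \<Longrightarrow> x \<oplus> (- 1) \<odot> x = \<zero>"
  using smult_add_left[of x 1 "-1"] by simp

lemma add_uminus_cancel:
  "x \<in> carrier V \<Longrightarrow> y \<in> carrier V \<Longrightarrow> x \<oplus> y \<oplus> (- 1) \<odot> y = x"
  by (simp add: a_assoc add_uminus)

lemma uminus_eq: "x \<in> carrier V \<Longrightarrow> \<ominus> x = (- 1) \<odot> x"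
  by (metis M.add.inv_closed M.minus_equality M.add.m_comm add_uminus smult_carrier)

end

sublocale normed_space \<subseteq> scalar_module V
  by unfold_locales

section \<open>The Hahn--Banach theorem\<close>

text \<open>
  Positive homogeneity is required as an inequality, which is easier to establish for infima and
  implies the equality.
\<close>

definition sublinear_on :: "('k::real_or_complex, 'v, 'm) normed_module_scheme \<Rightarrow> ('v \<Rightarrow> real) \<Rightarrow> bool" where
  "sublinear_on V p \<longleftrightarrow>
     (\<forall>x\<in>carrier V. \<forall>y\<in>carrier V. p (x \<oplus>\<^bsub>V\<^esub> y) \<le> p x + p y) \<and>
     (\<forall>x\<in>carrier V. \<forall>r\<ge>0. p (of_real r \<odot>\<^bsub>V\<^esub> x) \<le> r * p x)"

context scalar_module
begin

lemma sublinear_onD: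
  assumes "sublinear_on V p" "x \<in> carrier V"
  shows "y \<in> carrier V \<Longrightarrow> p (x \<oplus> y) \<le> p x + p y"
    and "0 \<le> r \<Longrightarrow> p (of_real r \<odot> x) \<le> r * p x"
  using assms by (auto simp: sublinear_on_def)

lemma sublinear_on_zero: "sublinear_on V p \<Longrightarrow> p \<zero> = 0"
  using sublinear_onD(1)[of p "\<zero>" "\<zero>"] sublinear_onD(2)[of p "\<zero>" 0] by simp

lemma sublinear_on_lower: 
  assumes p: "sublinear_on V p" and x: "x \<in> carrier V"
  shows "- p ((- 1) \<odot> x) \<le> p x"
  using sublinear_onD(1)[OF p x, of "(- 1) \<odot> x"] sublinear_on_zero[OF p] x
  by (simp add: add_uminus)

lemma sublinear_on_scale:
  assumes p: "sublinear_on V p" and x: "x \<in> carrier V" and r: "0 \<le> r"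
  shows "p (of_real r \<odot> x) = r * p x"
proof (cases "r = 0")
  case True
  then show ?thesis using x sublinear_on_zero[OF p] by simp
next
  case False
  then have "p x \<le> (1 / r) * p (of_real r \<odot> x)"
    using sublinear_onD(2)[OF p, of "of_real r \<odot> x" "1 / r"] x r
    by (simp add: smult_smult flip: of_real_mult)
  then show ?thesis
    using sublinear_onD(2)[OF p x r] r False by (simp add: field_simps)
qed

text \<open>
  The witness is the infimum of \<open>p (x + k) - w k\<close> over \<open>k\<close> in the cone. It serves twice: with a
  half-line it shows that minimal sublinear functionals are additive, and with a subspace it forces
  an additive functional below the result to extend the given functional.
\<close>

lemma sublinear_below_on_cone:
  assumes p: "sublinear_on V p"
    and K: "K \<subseteq> carrier V" "\<zero> \<in> K" "\<And>k l. k \<in> K \<Longrightarrow> l \<in> K \<Longrightarrow> k \<oplus> l \<in> K"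
      "\<And>r k. 0 \<le> r \<Longrightarrow> k \<in> K \<Longrightarrow> of_real r \<odot> k \<in> K"
    and w: "\<And>k l. k \<in> K \<Longrightarrow> l \<in> K \<Longrightarrow> w k + w l \<le> w (k \<oplus> l)"
      "\<And>r k. 0 \<le> r \<Longrightarrow> k \<in> K \<Longrightarrow> r * w k \<le> w (of_real r \<odot> k)"
      "\<And>k. k \<in> K \<Longrightarrow> w k \<le> p k"
  shows "\<exists>q. sublinear_on V q \<and> (\<forall>x\<in>carrier V. q x \<le> p x) \<and>
    (\<forall>k\<in>K. q ((- 1) \<odot> k) \<le> - w k)"
proof -
  define q where "q = (\<lambda>x. INF k\<in>K. p (x \<oplus> k) - w k)"
  have lower: "- p ((- 1) \<odot> x) \<le> p (x \<oplus> k) - w k" if "x \<in> carrier V" "k \<in> K" for x k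
  proof -
    have k: "k \<in> carrier V" using that K by blast
    have "k = (x \<oplus> k) \<oplus> (- 1) \<odot> x"
      using that k add_uminus_cancel[of k x] by (simp add: a_comm)
    then have "p k \<le> p (x \<oplus> k) + p ((- 1) \<odot> x)"
      using sublinear_onD(1)[OF p, of "x \<oplus> k" "(- 1) \<odot> x"] that k by simp
    then show ?thesis using w(3)[OF that(2)] by simp
  qed
  have q_le: "q x \<le> p (x \<oplus> k) - w k" if "x \<in> carrier V" "k \<in> K" for x k
    unfolding q_def by (rule cINF_lower[OF bdd_belowI2[OF lower[OF that(1)]] that(2)])
  have q_ge: "c \<le> q x" if "\<And>k. k \<in> K \<Longrightarrow> c \<le> p (x \<oplus> k) - w k" for c x
    unfolding q_def by (rule cINF_greatest) (use K that in auto)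
  have w0: "0 \<le> w \<zero>" using w(2)[of 0 "\<zero>"] K by auto
  show ?thesis
  proof (intro exI[of _ q] conjI ballI)
    show "sublinear_on V q"
      unfolding sublinear_on_def
    proof (intro conjI ballI allI impI)
      fix x y assume x: "x \<in> carrier V" and y: "y \<in> carrier V"
      have *: "q (x \<oplus> y) \<le> (p (x \<oplus> k) - w k) + (p (y \<oplus> l) - w l)" if "k \<in> K" "l \<in> K" for k l
      proof -
        have kl: "k \<in> carrier V" "l \<in> carrier V" using that K by auto
        have "(x \<oplus> y) \<oplus> (k \<oplus> l) = (x \<oplus> k) \<oplus> (y \<oplus> l)"
          using x y kl by (simp add: a_ac)
        then show ?thesis
          using q_le[of "x \<oplus> y" "k \<oplus> l"] w(1)[OF that] K(3)[OF that] x y kl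
            sublinear_onD(1)[OF p, of "x \<oplus> k" "y \<oplus> l"] by simp
      qed
      have "q (x \<oplus> y) - (p (x \<oplus> k) - w k) \<le> q y" if "k \<in> K" for k
        by (rule q_ge) (use *[OF that] in force)
      then have "q (x \<oplus> y) - q y \<le> q x"
        by (intro q_ge) force
      then show "q (x \<oplus> y) \<le> q x + q y" by simp
    next
      fix x and r :: real assume x: "x \<in> carrier V" and r: "0 \<le> r"
      show "q (of_real r \<odot> x) \<le> r * q x"
      proof (cases "r = 0")
        case True
        then show ?thesis
          using q_le[of "\<zero>" "\<zero>"] x K(2) w0 sublinear_on_zero[OF p] by simp
      next
        case False
        then have "q (of_real r \<odot> x) / r \<le> q x"
        proof (intro q_ge)
          fix k assume k: "k \<in> K"
          have kc: "k \<in> carrier V" using k K by auto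
          have "q (of_real r \<odot> x) \<le> p (of_real r \<odot> (x \<oplus> k)) - w (of_real r \<odot> k)"
            using q_le[of "of_real r \<odot> x" "of_real r \<odot> k"] K(4)[OF r k] x kc
            by (simp add: smult_add_right)
          also have "\<dots> \<le> r * (p (x \<oplus> k) - w k)"
            using sublinear_onD(2)[OF p, of "x \<oplus> k" r] w(2)[OF r k] x kc r
            by (simp add: algebra_simps)
          finally show "q (of_real r \<odot> x) / r \<le> p (x \<oplus> k) - w k"
            using False r by (simp add: field_simps)
        qed
        then show ?thesis using False r by (simp add: field_simps)
      qed
    qed
  next
    fix x assume "x \<in> carrier V"
    then show "q x \<le> p x" using q_le[of x "\<zero>"] K w0 by simp
  next
    fix k assume k: "k \<in> K"
    then have "k \<in> carrier V" using K by auto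
    then show "q ((- 1) \<odot> k) \<le> - w k"
      using q_le[of "(- 1) \<odot> k" k] k sublinear_on_zero[OF p] add_uminus[of k]
      by (simp add: a_comm)
  qed
qed

text \<open>
  Zorn's lemma applies because sublinear functionals below \<open>p\<close> are bounded below pointwise, by
  \<open>- p (- x)\<close>, and the pointwise infimum of a chain of them is again subadditive: two members of the
  chain can be replaced by the smaller one. Restricting to extensional functions makes the
  pointwise order antisymmetric.
\<close>

lemma minimal_sublinear_exists:
  assumes p: "sublinear_on V p"
  shows "\<exists>q. sublinear_on V q \<and> (\<forall>x\<in>carrier V. q x \<le> p x) \<and>
    (\<forall>q'. sublinear_on V q' \<longrightarrow> (\<forall>x\<in>carrier V. q' x \<le> q x) \<longrightarrow> (\<forall>x\<in>carrier V. q' x = q x))"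
proof -
  define A where
    "A = {q \<in> extensional (carrier V). sublinear_on V q \<and> (\<forall>x\<in>carrier V. q x \<le> p x)}"
  define P where "P = (\<lambda>q q'. \<forall>x\<in>carrier V. (q' x :: real) \<le> q x)"
  have ext: "restrict q (carrier V) \<in> A" 
    if "sublinear_on V q" "\<And>x. x \<in> carrier V \<Longrightarrow> q x \<le> p x" for q
    using that by (auto simp: A_def sublinear_on_def)
  have "partial_order_on A (relation_of P A)"
  proof (rule partial_order_on_relation_ofI)
    show "P a c" if "P a b" "P b c" for a b c
      using that by (fastforce simp: P_def intro: order_trans)
    show "a = b" if "a \<in> A" "b \<in> A" "P a b" "P b a" for a b
      using that by (intro extensionalityI[of a "carrier V" b]) (auto simp: A_def P_def intro: order_antisym)
  qed (simp add: P_def)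
  moreover have "\<exists>u\<in>A. \<forall>q\<in>C. P q u" if C: "C \<in> Chains (relation_of P A)" for C
  proof (cases "C = {}")
    case True
    then show ?thesis using ext[OF p] by auto
  next
    case False
    have CA: "q \<in> A" if "q \<in> C" for q
      using C that by (auto simp: Chains_def relation_of_def)
    have sub: "sublinear_on V q" and le_p: "\<And>x. x \<in> carrier V \<Longrightarrow> q x \<le> p x" if "q \<in> C" for q
      using CA[OF that] by (auto simp: A_def)
    have chain: "P q q' \<or> P q' q" if "q \<in> C" "q' \<in> C" for q q'
      using C that by (auto simp: Chains_def relation_of_def)
    define u where "u = (\<lambda>x. INF q\<in>C. q x)"
    have lower: "- p ((- 1) \<odot> x) \<le> q x" if "x \<in> carrier V" "q \<in> C" for x q
      using sublinear_on_lower[OF sub[OF that(2)] that(1)] le_p[OF that(2), of "(- 1) \<odot> x"] that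
      by simp
    have u_le: "u x \<le> q x" if "x \<in> carrier V" "q \<in> C" for x q
      unfolding u_def by (rule cINF_lower[OF bdd_belowI2[OF lower[OF that(1)]] that(2)])
    have u_ge: "c \<le> u x" if "\<And>q. q \<in> C \<Longrightarrow> c \<le> q x" for c x
      unfolding u_def by (rule cINF_greatest) (use False that in auto)
    have "sublinear_on V u"
      unfolding sublinear_on_def
    proof (intro conjI ballI allI impI)
      fix x y assume x: "x \<in> carrier V" and y: "y \<in> carrier V"
      have *: "u (x \<oplus> y) \<le> q x + q' y" if qq: "q \<in> C" "q' \<in> C" for q q'
        using chain[OF qq]
      proof
        assume "P q q'"
        then show ?thesis
          using u_le[of "x \<oplus> y" q'] sublinear_onD(1)[OF sub[OF qq(2)] x y] x y qq
          by (force simp: P_def)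
      next
        assume "P q' q"
        then show ?thesis
          using u_le[of "x \<oplus> y" q] sublinear_onD(1)[OF sub[OF qq(1)] x y] x y qq
          by (force simp: P_def)
      qed
      have "u (x \<oplus> y) - q x \<le> u y" if "q \<in> C" for q
        by (rule u_ge) (use *[OF that] in force)
      then have "u (x \<oplus> y) - u y \<le> u x"
        by (intro u_ge) force
      then show "u (x \<oplus> y) \<le> u x + u y" by simp
    next
      fix x and r :: real assume x: "x \<in> carrier V" and r: "0 \<le> r"
      show "u (of_real r \<odot> x) \<le> r * u x"
      proof (cases "r = 0")
        case True
        obtain q where "q \<in> C" using False by blast
        then show ?thesis
          using True u_le[of "\<zero>" q] x sublinear_on_zero[OF sub[of q]] by simp
      next
        case r0: False
        have "u (of_real r \<odot> x) / r \<le> u x"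
        proof (rule u_ge)
          fix q assume q: "q \<in> C"
          show "u (of_real r \<odot> x) / r \<le> q x"
            using u_le[of "of_real r \<odot> x" q] sublinear_onD(2)[OF sub[OF q] x r] x q r r0
            by (simp add: field_simps)
        qed
        then show ?thesis using r r0 by (simp add: field_simps)
      qed
    qed
    moreover have "u x \<le> p x" if x: "x \<in> carrier V" for x
    proof -
      obtain q where "q \<in> C" using False by blast
      then show ?thesis using u_le[of x q] le_p[of q x] x by linarith
    qed
    ultimately have "restrict u (carrier V) \<in> A" by (rule ext)
    moreover have "\<forall>q\<in>C. P q (restrict u (carrier V))"
      using u_le by (simp add: P_def)
    ultimately show ?thesis by blast
  qed
  ultimately have "\<exists>q\<in>A. \<forall>a\<in>A. P q a \<longrightarrow> a = q"
    by (rule predicate_Zorn)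
  then obtain q where q: "q \<in> A" and min: "\<And>a. a \<in> A \<Longrightarrow> P q a \<Longrightarrow> a = q" by blast
  have "q' x = q x"
    if q': "sublinear_on V q'" "\<forall>x\<in>carrier V. q' x \<le> q x" and x: "x \<in> carrier V" for q' x
  proof -
    have "restrict q' (carrier V) \<in> A"
      by (rule ext) (use q' q in \<open>auto simp: A_def intro: order_trans\<close>)
    then have "restrict q' (carrier V) = q"
      by (rule min) (use q' in \<open>simp add: P_def\<close>)
    then show ?thesis using x by (metis restrict_apply')
  qed
  then show ?thesis using q by (auto simp: A_def)
qed

text \<open>
  A minimal sublinear functional \<open>u\<close> is real-linear: if \<open>u (- z)\<close> were larger than \<open>- u z\<close>, then pushing
  \<open>u\<close> down along the half-line through \<open>z\<close> would yield a strictly smaller sublinear functional.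
\<close>

lemma additive_below_sublinear:
  assumes p: "sublinear_on V p"
  shows "\<exists>u. (\<forall>x\<in>carrier V. \<forall>y\<in>carrier V. u (x \<oplus> y) = u x + u y) \<and>
    (\<forall>r. \<forall>x\<in>carrier V. u (of_real r \<odot> x) = r * u x) \<and> (\<forall>x\<in>carrier V. u x \<le> p x)"
proof -
  obtain u where u: "sublinear_on V u" and le: "\<And>x. x \<in> carrier V \<Longrightarrow> u x \<le> p x"
    and min: "\<And>q' x. sublinear_on V q' \<Longrightarrow> \<forall>x\<in>carrier V. q' x \<le> u x \<Longrightarrow> x \<in> carrier V
        \<Longrightarrow> q' x = u x"
    using minimal_sublinear_exists[OF p] by blast
  have neg: "u ((- 1) \<odot> z) = - u z" if z: "z \<in> carrier V" for z
  proof -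
    define K where "K = {of_real t \<odot> z | t. 0 \<le> (t::real)}"
    have in_K: "of_real t \<odot> z \<in> K" if "0 \<le> t" for t
      using that by (auto simp: K_def)
    have "\<zero> \<in> K" using in_K[of 0] z by simp
    moreover have "k \<oplus> l \<in> K" and "u k + u l \<le> u (k \<oplus> l)" if kl: "k \<in> K" "l \<in> K" for k l
    proof -
      obtain s t where st: "0 \<le> s" "0 \<le> t" "k = of_real s \<odot> z" "l = of_real t \<odot> z"
        using kl by (auto simp: K_def)
      then have "k \<oplus> l = of_real (s + t) \<odot> z" using z by (simp add: smult_add_left)
      then show "k \<oplus> l \<in> K" and "u k + u l \<le> u (k \<oplus> l)"
        using st in_K[of "s + t"] sublinear_on_scale[OF u z]
        by (simp_all add: algebra_simps del: of_real_add)
    qed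
    moreover have "of_real r \<odot> k \<in> K" if "0 \<le> r" "k \<in> K" for r k
      using that z in_K by (auto simp: K_def smult_smult simp flip: of_real_mult)
    moreover have Kc: "K \<subseteq> carrier V" using z by (auto simp: K_def)
    moreover have "r * u k \<le> u (of_real r \<odot> k)" if "0 \<le> r" "k \<in> K" for r k
      using sublinear_on_scale[OF u _ that(1), of k] Kc that by auto
    ultimately have "\<exists>q. sublinear_on V q \<and> (\<forall>x\<in>carrier V. q x \<le> u x) \<and>
        (\<forall>k\<in>K. q ((- 1) \<odot> k) \<le> - u k)"
      by (intro sublinear_below_on_cone u) auto
    then obtain q where "sublinear_on V q" "\<forall>x\<in>carrier V. q x \<le> u x"
        "\<forall>k\<in>K. q ((- 1) \<odot> k) \<le> - u k"
      by blast
    then have "u ((- 1) \<odot> z) \<le> - u z"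
      using min[of q "(- 1) \<odot> z"] in_K[of 1] z by force
    then show ?thesis using sublinear_on_lower[OF u z] by linarith
  qed
  show ?thesis
  proof (intro exI[of _ u] conjI ballI allI)
    fix x y assume x: "x \<in> carrier V" and y: "y \<in> carrier V"
    then have "u x \<le> u (x \<oplus> y) - u y"
      using sublinear_onD(1)[OF u, of "x \<oplus> y" "(- 1) \<odot> y"] add_uminus_cancel neg by simp
    then show "u (x \<oplus> y) = u x + u y" using sublinear_onD(1)[OF u x y] by simp
  next
    fix r :: real and x assume x: "x \<in> carrier V"
    show "u (of_real r \<odot> x) = r * u x"
    proof (cases "0 \<le> r")
      case True
      then show ?thesis using sublinear_on_scale[OF u x] by simp
    next
      case False
      have "of_real r \<odot> x = (- 1) \<odot> (of_real (- r) \<odot> x)"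
        using x by (simp add: smult_smult)
      then show ?thesis
        using sublinear_on_scale[OF u x, of "- r"] False x neg[of "of_real (- r) \<odot> x"] by simp
    qed
  qed (rule le)
qed

text \<open>
  The real part of \<open>f\<close> is extended first. A scalar-linear functional is recovered from its real part
  \<open>u\<close> as \<open>u x - u (\<iota> x) \<iota>\<close>, and a rotation turns the bound on \<open>u\<close> into one on its modulus.
\<close>

theorem Hahn_Banach:
  assumes p_add: "\<And>x y. x \<in> carrier V \<Longrightarrow> y \<in> carrier V \<Longrightarrow> p (x \<oplus> y) \<le> p x + p y"
    and p_scale: "\<And>c x. x \<in> carrier V \<Longrightarrow> p (c \<odot> x) = norm c * p x"
    and S: "S \<subseteq> carrier V" "\<zero> \<in> S" "\<And>x y. x \<in> S \<Longrightarrow> y \<in> S \<Longrightarrow> x \<oplus> y \<in> S"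
      "\<And>c x. x \<in> S \<Longrightarrow> c \<odot> x \<in> S"
    and f: "\<And>x y. x \<in> S \<Longrightarrow> y \<in> S \<Longrightarrow> f (x \<oplus> y) = f x + f y"
      "\<And>c x. x \<in> S \<Longrightarrow> f (c \<odot> x) = c * f x"
      "\<And>x. x \<in> S \<Longrightarrow> norm (f x) \<le> p x"
  obtains g where "linear_map V (scalars :: ('k, 'k) normed_module) g" "\<And>x. x \<in> S \<Longrightarrow> g x = f x"
    "\<And>x. x \<in> carrier V \<Longrightarrow> norm (g x) \<le> p x"
proof -
  obtain re :: "'k \<Rightarrow> real" and \<iota> where re: "\<And>a b. re (a + b) = re a + re b"
      "\<And>r a. re (of_real r * a) = r * re a" "\<And>r. re (of_real r) = r"
      "\<And>a. re a \<le> norm a" 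
    and decomp: "\<And>a. a = of_real (re a) - of_real (re (\<iota> * a)) * \<iota>"
    and \<iota>: "\<iota> = 0 \<or> \<iota> * \<iota> = - 1"
    using scalar_real_part[where 'k = 'k] by blast
  have S_c: "x \<in> S \<Longrightarrow> x \<in> carrier V" for x using S(1) by blast
  have "sublinear_on V p"
    using p_add p_scale by (simp add: sublinear_on_def)
  moreover have "re (f s) \<le> p s" if "s \<in> S" for s
    using re(4)[of "f s"] f(3)[OF that] by linarith
  ultimately have "\<exists>q. sublinear_on V q \<and> (\<forall>x\<in>carrier V. q x \<le> p x) \<and>
      (\<forall>s\<in>S. q ((- 1) \<odot> s) \<le> - re (f s))"
    by (intro sublinear_below_on_cone) (simp_all add: S f re)
  then obtain q where q: "sublinear_on V q" "\<And>x. x \<in> carrier V \<Longrightarrow> q x \<le> p x"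
      "\<And>s. s \<in> S \<Longrightarrow> q ((- 1) \<odot> s) \<le> - re (f s)"
    by blast
  obtain u where u_add: "\<And>x y. x \<in> carrier V \<Longrightarrow> y \<in> carrier V \<Longrightarrow> u (x \<oplus> y) = u x + u y"
    and u_scale: "\<And>r x. x \<in> carrier V \<Longrightarrow> u (of_real r \<odot> x) = r * u x"
    and u_le: "\<And>x. x \<in> carrier V \<Longrightarrow> u x \<le> q x"
    using additive_below_sublinear[OF q(1)] by blast
  have u_neg: "u ((- 1) \<odot> x) = - u x" if "x \<in> carrier V" for x
    using u_scale[OF that, of "-1"] by simp
  have f_neg: "f ((- 1) \<odot> x) = - f x" if "x \<in> S" for x
    using f(2)[OF that, of "-1"] by simp
  have re_neg: "re (- a) = - re a" for a using re(2)[of "-1" a] by simp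
  have u_ge: "re (f s) \<le> u s" if s: "s \<in> S" for s
    using u_le[of "(- 1) \<odot> s"] q(3)[OF s] u_neg[OF S_c[OF s]] S_c[OF s] by simp
  have u_eq: "u s = re (f s)" if s: "s \<in> S" for s
    using u_ge[OF s] u_ge[of "(- 1) \<odot> s"] S(4)[OF s, of "-1"] u_neg[OF S_c[OF s]]
    by (simp add: f_neg[OF s] re_neg)
  define g where "g = (\<lambda>x. of_real (u x) - of_real (u (\<iota> \<odot> x)) * \<iota>)"
  have g_add: "g (x \<oplus> y) = g x + g y" if "x \<in> carrier V" "y \<in> carrier V" for x y
    using that by (simp add: g_def u_add smult_add_right algebra_simps)
  have g_real: "g (of_real r \<odot> x) = of_real r * g x" if x: "x \<in> carrier V" for r x
  proof -
    have "u (\<iota> \<odot> (of_real r \<odot> x)) = r * u (\<iota> \<odot> x)"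
      using u_scale[of "\<iota> \<odot> x" r] x by (simp add: smult_smult mult.commute)
    then show ?thesis using x by (simp add: g_def u_scale algebra_simps)
  qed
  have g_\<iota>: "g (\<iota> \<odot> x) = \<iota> * g x" if x: "x \<in> carrier V" for x
    using \<iota>
  proof
    assume "\<iota> = 0"
    then show ?thesis using x u_scale[of "\<zero>" 0] by (simp add: g_def)
  next
    assume \<iota>2: "\<iota> * \<iota> = - 1"
    have "\<iota> * g x = of_real (u x) * \<iota> - of_real (u (\<iota> \<odot> x)) * (\<iota> * \<iota>)"
      by (simp add: g_def algebra_simps)
    then show ?thesis using x \<iota>2 u_neg by (simp add: g_def smult_smult)
  qed
  have g_scale: "g (c \<odot> x) = c * g x" if x: "x \<in> carrier V" for c x
  proof -
    define b where "b = - re (\<iota> * c)"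
    have c: "c = of_real (re c) + of_real b * \<iota>"
      using decomp[of c] by (simp add: b_def)
    have "g (c \<odot> x) = g (of_real (re c) \<odot> x \<oplus> of_real b \<odot> (\<iota> \<odot> x))"
      using x by (subst c) (simp add: smult_add_left smult_smult)
    also have "\<dots> = (of_real (re c) + of_real b * \<iota>) * g x"
      using x by (simp add: g_add g_real g_\<iota> algebra_simps)
    finally show ?thesis using c by simp
  qed
  have g_eq: "g s = f s" if s: "s \<in> S" for s
    using decomp[of "f s"] u_eq[OF s] u_eq[OF S(4)[OF s, of \<iota>]] f(2)[OF s] by (simp add: g_def)
  have g_le: "norm (g x) \<le> p x" if x: "x \<in> carrier V" for x
  proof (cases "g x = 0")
    case True
    then show ?thesis
      using p_add[of x "(- 1) \<odot> x"] p_scale[OF x, of "-1"] p_scale[of "\<zero>" 0] x by (simp add: add_uminus)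
  next
    case False
    \<comment> \<open>The scalar that rotates the value to the positive real axis, where it equals its real part.\<close>
    define c where "c = of_real (norm (g x)) / g x"
    have c: "norm c = 1" using False by (simp add: c_def norm_divide)
    have "of_real (norm (g x)) = g (c \<odot> x)"
      using False g_scale[OF x, of c] by (simp add: c_def)
    then have "norm (g x) = re (g (c \<odot> x))" using re(3) by metis
    also have "\<dots> = u (c \<odot> x)"
    proof -
      have re_\<iota>: "re \<iota> = 0"
      proof -
        have "\<iota> = of_real (re \<iota>) - of_real (re (\<iota> * \<iota>)) * \<iota>" by (rule decomp)
        then show ?thesis using \<iota> re(3)[of 0] re_neg[of 1] re(3)[of 1] by auto
      qed
      show ?thesis
        using re(1)[of "g (c \<odot> x)" "of_real (u (\<iota> \<odot> (c \<odot> x))) * \<iota>"] re(2)[of _ \<iota>] re(3) re_\<iota>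
        by (simp add: g_def)
    qed
    also have "\<dots> \<le> p (c \<odot> x)"
      using u_le[of "c \<odot> x"] q(2)[of "c \<odot> x"] x by simp
    also have "\<dots> = p x" using p_scale[OF x] c by simp
    finally show ?thesis .
  qed
  show thesis
    by (rule that[of g]) (use g_add g_scale g_eq g_le in \<open>auto simp: linear_map_def\<close>)
qed

end

section \<open>Dual spaces and adjoints\<close>

lemma in_dual_iff:
  "f \<in> carrier (dual V) \<longleftrightarrow> f \<in> extensional (carrier V) \<and> linear_map V scalars f \<and>
     (\<exists>B. \<forall>x\<in>carrier V. norm (f x) \<le> B * vnorm V x)"
  by (simp add: dual_def)

lemma dual_apply [simp]:
  assumes "x \<in> carrier V"
  shows "(f \<oplus>\<^bsub>dual V\<^esub> g) x = f x + g x" "(c \<odot>\<^bsub>dual V\<^esub> f) x = c * f x" "\<zero>\<^bsub>dual V\<^esub> x = 0"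
  using assms by (simp_all add: dual_def)

lemma dual_eqI:
  "f \<in> carrier (dual V) \<Longrightarrow> g \<in> carrier (dual V) \<Longrightarrow> (\<And>x. x \<in> carrier V \<Longrightarrow> f x = g x) \<Longrightarrow> f = g"
  by (auto simp: in_dual_iff intro: extensionalityI)

lemma linear_mapD:
  assumes "linear_map V W f" "x \<in> carrier V"
  shows "f x \<in> carrier W" "y \<in> carrier V \<Longrightarrow> f (x \<oplus>\<^bsub>V\<^esub> y) = f x \<oplus>\<^bsub>W\<^esub> f y"
    "f (c \<odot>\<^bsub>V\<^esub> x) = c \<odot>\<^bsub>W\<^esub> f x"
  using assms by (auto simp: linear_map_def)

lemma dual_linear:
  assumes "f \<in> carrier (dual V)" "x \<in> carrier V"
  shows "y \<in> carrier V \<Longrightarrow> f (x \<oplus>\<^bsub>V\<^esub> y) = f x + f y" "f (c \<odot>\<^bsub>V\<^esub> x) = c * f x"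
  using assms linear_mapD[of V scalars f x] by (auto simp: in_dual_iff)

context normed_space
begin

lemma vnorm_zero [simp]: "vnorm V \<zero> = 0"
  by (simp add: vnorm_eq_0_iff)

lemma vnorm_nonneg: "x \<in> carrier V \<Longrightarrow> 0 \<le> vnorm V x"
  using vnorm_triangle[of x "(- 1) \<odot> x"] by (simp add: vnorm_smult add_uminus)

lemma norm_le_if_unit_ball:
  assumes f: "\<And>c y. y \<in> carrier V \<Longrightarrow> f (c \<odot> y) = c * f y"
    and C: "\<And>y. y \<in> carrier V \<Longrightarrow> vnorm V y \<le> 1 \<Longrightarrow> norm (f y) \<le> C"
    and x: "x \<in> carrier V"
  shows "norm (f x) \<le> C * vnorm V x"
proof (cases "x = \<zero>")
  case True
  then show ?thesis using f[of "\<zero>" 0] by simp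
next
  case False
  then have pos: "0 < vnorm V x" using vnorm_nonneg[OF x] vnorm_eq_0_iff[OF x] by linarith
  have "norm (f (of_real (1 / vnorm V x) \<odot> x)) \<le> C"
    by (rule C) (use x pos in \<open>simp_all add: vnorm_smult norm_divide\<close>)
  then show ?thesis
    using pos f[OF x] by (simp add: norm_mult norm_divide field_simps)
qed

lemma dual_norm_upper:
  assumes f: "f \<in> carrier (dual V)" and x: "x \<in> carrier V" "vnorm V x \<le> 1"
  shows "norm (f x) \<le> vnorm (dual V) f"
proof -
  obtain B where B: "\<And>x. x \<in> carrier V \<Longrightarrow> norm (f x) \<le> B * vnorm V x"
    using f by (auto simp: in_dual_iff)
  have "norm (f z) \<le> \<bar>B\<bar>" if z: "z \<in> carrier V" "vnorm V z \<le> 1" for z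
  proof -
    have "B * vnorm V z \<le> \<bar>B\<bar> * 1"
      by (intro mult_mono) (use vnorm_nonneg[OF z(1)] z(2) in auto)
    then show ?thesis using B[OF z(1)] by simp
  qed
  then have "bdd_above ((\<lambda>x. norm (f x)) ` {x \<in> carrier V. vnorm V x \<le> 1})"
    by (intro bdd_aboveI2[where M = "\<bar>B\<bar>"]) auto
  then have "norm (f x) \<le> (SUP x\<in>{x \<in> carrier V. vnorm V x \<le> 1}. norm (f x))"
    by (intro cSUP_upper[where f = "\<lambda>x. norm (f x)"]) (simp_all add: x)
  then show ?thesis by (simp add: dual_def)
qed

lemma dual_norm_nonneg: "f \<in> carrier (dual V) \<Longrightarrow> 0 \<le> vnorm (dual V) f"
  using order_trans[OF norm_ge_zero dual_norm_upper[of f "\<zero>"]] by simp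

lemma dual_norm_bound:
  assumes f: "f \<in> carrier (dual V)" and x: "x \<in> carrier V"
  shows "norm (f x) \<le> vnorm (dual V) f * vnorm V x"
  by (rule norm_le_if_unit_ball[OF dual_linear(2)[OF f] dual_norm_upper[OF f] x])

lemma dual_norm_bound':
  "f \<in> carrier (dual V) \<Longrightarrow> x \<in> carrier V \<Longrightarrow> norm (f x) \<le> vnorm V x * vnorm (dual V) f"
  using dual_norm_bound[of f x] by (simp add: mult.commute)

lemma dual_norm_leI:
  assumes "0 \<le> C" and "\<And>x. x \<in> carrier V \<Longrightarrow> norm (f x) \<le> C * vnorm V x"
  shows "vnorm (dual V) f \<le> C"
proof -
  have "norm (f x) \<le> C" if "x \<in> carrier V" "vnorm V x \<le> 1" for x
    using assms(2)[OF that(1)] mult_left_mono[OF that(2) assms(1)] by simp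
  moreover have "\<zero> \<in> {x \<in> carrier V. vnorm V x \<le> 1}" by simp
  ultimately have "(SUP x\<in>{x \<in> carrier V. vnorm V x \<le> 1}. norm (f x)) \<le> C"
    by (intro cSUP_least) blast+
  then show ?thesis by (simp add: dual_def)
qed

lemma restrict_in_dual:
  assumes "\<And>x y. x \<in> carrier V \<Longrightarrow> y \<in> carrier V \<Longrightarrow> f (x \<oplus> y) = f x + f y"
    and "\<And>c x. x \<in> carrier V \<Longrightarrow> f (c \<odot> x) = c * f x"
    and "\<And>x. x \<in> carrier V \<Longrightarrow> norm (f x) \<le> B * vnorm V x"
  shows "restrict f (carrier V) \<in> carrier (dual V)"
  using assms by (auto simp: in_dual_iff linear_map_def intro!: exI[of _ B])

lemma dual_zero_closed: "\<zero>\<^bsub>dual V\<^esub> \<in> carrier (dual V)"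
proof -
  have "restrict (\<lambda>x. 0) (carrier V) \<in> carrier (dual V)"
    by (rule restrict_in_dual[where B = 0]) auto
  then show ?thesis by (simp add: dual_def)
qed

lemma dual_closed:
  assumes "f \<in> carrier (dual V)"
  shows "g \<in> carrier (dual V) \<Longrightarrow> f \<oplus>\<^bsub>dual V\<^esub> g \<in> carrier (dual V)"
    and "c \<odot>\<^bsub>dual V\<^esub> f \<in> carrier (dual V)"
proof -
  note [simp] = dual_linear[OF assms]
  show "f \<oplus>\<^bsub>dual V\<^esub> g \<in> carrier (dual V)" if g: "g \<in> carrier (dual V)"
  proof -
    have "restrict (\<lambda>x. f x + g x) (carrier V) \<in> carrier (dual V)"
      by (rule restrict_in_dual[where B = "vnorm (dual V) f + vnorm (dual V) g"])
        (use g in \<open>auto simp: dual_linear[OF g] algebra_simps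
           intro!: order_trans[OF norm_triangle_ineq] add_mono dual_norm_bound' assms\<close>)
    then show ?thesis by (simp add: dual_def)
  qed
  have "restrict (\<lambda>x. c * f x) (carrier V) \<in> carrier (dual V)"
    by (rule restrict_in_dual[where B = "norm c * vnorm (dual V) f"])
      (auto simp: algebra_simps norm_mult intro!: mult_left_mono dual_norm_bound'[OF assms])
  then show "c \<odot>\<^bsub>dual V\<^esub> f \<in> carrier (dual V)" by (simp add: dual_def)
qed


theorem normed_space_dual: "normed_space (dual V)"
proof -
  have uminus: "(- 1) \<odot>\<^bsub>dual V\<^esub> f \<oplus>\<^bsub>dual V\<^esub> f = \<zero>\<^bsub>dual V\<^esub>" if "f \<in> carrier (dual V)" for f
    by (rule dual_eqI[of _ V]) (use that in \<open>simp_all add: dual_closed dual_zero_closed\<close>)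
  have "abelian_group (dual V)"
  proof (rule abelian_groupI)
    fix f assume f: "f \<in> carrier (dual V)"
    then show "\<exists>g\<in>carrier (dual V). g \<oplus>\<^bsub>dual V\<^esub> f = \<zero>\<^bsub>dual V\<^esub>"
      using uminus dual_closed(2) by blast
  qed (auto simp: dual_closed dual_zero_closed intro!: dual_eqI[of _ V])
  then have "module (scalars :: ('k, 'k) normed_module) (dual V)"
    by (intro moduleI) (auto simp: dual_closed dual_zero_closed algebra_simps is_cring intro!: dual_eqI[of _ V])
  moreover have "normed_space_axioms (dual V)"
  proof
    fix f assume f: "f \<in> carrier (dual V)"
    show "vnorm (dual V) f = 0 \<longleftrightarrow> f = \<zero>\<^bsub>dual V\<^esub>"
    proof
      assume "vnorm (dual V) f = 0"
      then show "f = \<zero>\<^bsub>dual V\<^esub>"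
        using dual_norm_bound[OF f] f by (intro dual_eqI[of _ V]) (auto simp: dual_closed dual_zero_closed)
    next
      assume "f = \<zero>\<^bsub>dual V\<^esub>"
      then have "vnorm (dual V) f \<le> 0"
        by (intro dual_norm_leI) auto
      then show "vnorm (dual V) f = 0" using dual_norm_nonneg[OF f] by simp
    qed
  next
    have le: "vnorm (dual V) (c \<odot>\<^bsub>dual V\<^esub> f) \<le> norm c * vnorm (dual V) f"
      if f: "f \<in> carrier (dual V)" for c f
      by (rule dual_norm_leI)
        (auto simp: norm_mult mult.assoc intro!: mult_left_mono dual_norm_bound f mult_nonneg_nonneg dual_norm_nonneg)
    fix f c assume f: "f \<in> carrier (dual V)"
    show "vnorm (dual V) (c \<odot>\<^bsub>dual V\<^esub> f) = norm c * vnorm (dual V) f"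
    proof (cases "c = 0")
      case True
      then show ?thesis using le[OF f, of 0] dual_norm_nonneg[OF dual_closed(2)[OF f, of 0]] by simp
    next
      case False
      have "(1 / c) \<odot>\<^bsub>dual V\<^esub> (c \<odot>\<^bsub>dual V\<^esub> f) = f"
        by (rule dual_eqI[of _ V]) (use False f in \<open>auto simp: dual_closed\<close>)
      then have "vnorm (dual V) f \<le> norm (1 / c) * vnorm (dual V) (c \<odot>\<^bsub>dual V\<^esub> f)"
        using le[OF dual_closed(2)[OF f, of c], of "1 / c"] by simp
      then show ?thesis
        using le[OF f, of c] False by (simp add: norm_divide field_simps)
    qed
  next
    fix f g assume f: "f \<in> carrier (dual V)" and g: "g \<in> carrier (dual V)"
    show "vnorm (dual V) (f \<oplus>\<^bsub>dual V\<^esub> g) \<le> vnorm (dual V) f + vnorm (dual V) g"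
      by (rule dual_norm_leI)
        (auto simp: algebra_simps intro!: order_trans[OF norm_triangle_ineq] add_mono
           dual_norm_bound' dual_norm_nonneg add_nonneg_nonneg f g)
  qed
  ultimately show ?thesis by (simp add: normed_space_def)
qed

lemma dual_minus_eq:
  assumes f: "f \<in> carrier (dual V)" and g: "g \<in> carrier (dual V)"
  shows "f \<ominus>\<^bsub>dual V\<^esub> g = f \<oplus>\<^bsub>dual V\<^esub> (- 1) \<odot>\<^bsub>dual V\<^esub> g"
proof -
  interpret D: normed_space "dual V" by (rule normed_space_dual)
  show ?thesis by (simp add: a_minus_def D.uminus_eq g)
qed

end

text \<open>
  Inclusions, canonical embeddings, L-projections and extension operators are all contractions,
  and iterated adjoints of contractions relate the higher duals of a space to those of a subspace.
\<close>

definition contraction ::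
    "('k, 'v, 'm) normed_module_scheme \<Rightarrow> ('k, 'w, 'n) normed_module_scheme \<Rightarrow> ('v \<Rightarrow> 'w) \<Rightarrow> bool" where
  "contraction V W R \<longleftrightarrow> linear_map V W R \<and> (\<forall>x\<in>carrier V. vnorm W (R x) \<le> vnorm V x)"

definition dual_adjoint ::
    "('k, 'v, 'm) normed_module_scheme \<Rightarrow> ('v \<Rightarrow> 'w) \<Rightarrow> ('w \<Rightarrow> 'k) \<Rightarrow> 'v \<Rightarrow> 'k" where
  "dual_adjoint V R f = (\<lambda>x\<in>carrier V. f (R x))"

lemma contractionD:
  assumes "contraction V W R" "x \<in> carrier V"
  shows "R x \<in> carrier W" "vnorm W (R x) \<le> vnorm V x"
    "y \<in> carrier V \<Longrightarrow> R (x \<oplus>\<^bsub>V\<^esub> y) = R x \<oplus>\<^bsub>W\<^esub> R y" "R (c \<odot>\<^bsub>V\<^esub> x) = c \<odot>\<^bsub>W\<^esub> R x"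
  using assms linear_mapD[of V W R x] by (auto simp: contraction_def)

lemma dual_adjoint_apply [simp]: "x \<in> carrier V \<Longrightarrow> dual_adjoint V R f x = f (R x)"
  by (simp add: dual_adjoint_def)

lemma contraction_dual_adjoint:
  assumes V: "normed_space V" and W: "normed_space W" and R: "contraction V W R"
  shows "contraction (dual W) (dual V) (dual_adjoint V R)"
proof -
  interpret V: normed_space V by (rule V)
  interpret W: normed_space W by (rule W)
  have bound: "norm (f (R x)) \<le> vnorm (dual W) f * vnorm V x"
    if f: "f \<in> carrier (dual W)" and x: "x \<in> carrier V" for f x
    using W.dual_norm_bound[OF f contractionD(1)[OF R x]]
      mult_left_mono[OF contractionD(2)[OF R x] W.dual_norm_nonneg[OF f]] by linarith
  have closed: "dual_adjoint V R f \<in> carrier (dual V)" if f: "f \<in> carrier (dual W)" for f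
    unfolding dual_adjoint_def
    by (rule V.restrict_in_dual[OF _ _ bound[OF f]])
      (simp_all add: contractionD[OF R] dual_linear[OF f])
  show ?thesis
    unfolding contraction_def linear_map_def
  proof (intro conjI ballI allI funcsetI closed)
    fix f g c assume f: "f \<in> carrier (dual W)"
    show "vnorm (dual V) (dual_adjoint V R f) \<le> vnorm (dual W) f"
      by (rule V.dual_norm_leI) (use bound[OF f] W.dual_norm_nonneg[OF f] in auto)
    show "dual_adjoint V R (c \<odot>\<^bsub>dual W\<^esub> f) = c \<odot>\<^bsub>dual V\<^esub> dual_adjoint V R f"
      by (rule dual_eqI[of _ V])
        (use f in \<open>simp_all add: closed V.dual_closed W.dual_closed contractionD[OF R]\<close>)
    assume g: "g \<in> carrier (dual W)"
    show "dual_adjoint V R (f \<oplus>\<^bsub>dual W\<^esub> g) = dual_adjoint V R f \<oplus>\<^bsub>dual V\<^esub> dual_adjoint V R g"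
      by (rule dual_eqI[of _ V])
        (use f g in \<open>simp_all add: closed V.dual_closed W.dual_closed contractionD[OF R]\<close>)
  qed
qed

context normed_space
begin

lemma bidual_embedding_apply [simp]: "f \<in> carrier (dual V) \<Longrightarrow> bidual_embedding V x f = f x"
  by (simp add: bidual_embedding_def)

lemma contraction_bidual_embedding: "contraction V (dual (dual V)) (bidual_embedding V)"
proof -
  interpret D: normed_space "dual V" by (rule normed_space_dual)
  have closed: "bidual_embedding V x \<in> carrier (dual (dual V))" if x: "x \<in> carrier V" for x
    unfolding bidual_embedding_def
    by (rule D.restrict_in_dual[where B = "vnorm V x"])
      (use x in \<open>simp_all add: dual_norm_bound'\<close>)
  show ?thesis
    unfolding contraction_def linear_map_def
  proof (intro conjI ballI allI funcsetI closed)
    fix x y c assume x: "x \<in> carrier V"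
    show "vnorm (dual (dual V)) (bidual_embedding V x) \<le> vnorm V x"
      by (rule D.dual_norm_leI) (use x in \<open>simp_all add: dual_norm_bound' vnorm_nonneg\<close>)
    show "bidual_embedding V (c \<odot> x) = c \<odot>\<^bsub>dual (dual V)\<^esub> bidual_embedding V x"
      by (rule dual_eqI[of _ "dual V"])
        (use x in \<open>simp_all add: closed D.dual_closed dual_linear\<close>)
    assume y: "y \<in> carrier V"
    show "bidual_embedding V (x \<oplus> y) = bidual_embedding V x \<oplus>\<^bsub>dual (dual V)\<^esub> bidual_embedding V y"
      by (rule dual_eqI[of _ "dual V"])
        (use x y in \<open>simp_all add: closed D.dual_closed dual_linear\<close>)
  qed
qed

subsection \<open>Consequences of the Hahn--Banach theorem\<close>

lemma norm_preserving_extension: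
  assumes J: "J \<subseteq> carrier V" and VJ: "normed_space (V\<lparr>carrier := J\<rparr>)"
    and h: "h \<in> carrier (dual (V\<lparr>carrier := J\<rparr>))"
  shows "\<exists>g\<in>carrier (dual V). vnorm (dual V) g \<le> vnorm (dual (V\<lparr>carrier := J\<rparr>)) h \<and> (\<forall>x\<in>J. g x = h x)"
proof -
  interpret S: normed_space "V\<lparr>carrier := J\<rparr>" by (rule VJ)
  define M where "M = vnorm (dual (V\<lparr>carrier := J\<rparr>)) h"
  have M: "0 \<le> M" using S.dual_norm_nonneg[OF h] by (simp add: M_def)
  obtain g where g: "linear_map V (scalars :: ('k, 'k) normed_module) g" "\<And>x. x \<in> J \<Longrightarrow> g x = h x"
      "\<And>x. x \<in> carrier V \<Longrightarrow> norm (g x) \<le> M * vnorm V x"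
  proof (rule Hahn_Banach[of "\<lambda>x. M * vnorm V x" J h])
    show "M * vnorm V (x \<oplus> y) \<le> M * vnorm V x + M * vnorm V y"
      if "x \<in> carrier V" "y \<in> carrier V" for x y
      using mult_left_mono[OF vnorm_triangle[OF that] M] by (simp add: algebra_simps)
    show "M * vnorm V (c \<odot> x) = norm c * (M * vnorm V x)" if "x \<in> carrier V" for c x
      using that by (simp add: vnorm_smult)
  qed (use J S.a_closed S.zero_closed S.smult_carrier dual_linear[OF h] S.dual_norm_bound[OF h]
      in \<open>auto simp: M_def\<close>)
  have "restrict g (carrier V) \<in> carrier (dual V)"
    by (rule restrict_in_dual[OF _ _ g(3)]) (use linear_mapD[OF g(1)] in auto)
  moreover have "vnorm (dual V) (restrict g (carrier V)) \<le> M"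
    by (rule dual_norm_leI[OF M]) (simp add: g(3))
  ultimately show ?thesis using g(2) J unfolding M_def by fastforce
qed

text \<open>
  On the span of \<open>J\<close> and \<open>x\<close>, the functional \<open>j + c x \<mapsto> c\<close> is dominated by the norm precisely because
  \<open>x\<close> has distance at least one from \<open>J\<close>; it is then extended to the whole space.
\<close>

lemma annihilating_functional:
  assumes J: "submodule J (scalars :: ('k, 'k) normed_module) V" and x: "x \<in> carrier V"
    and far: "\<And>j. j \<in> J \<Longrightarrow> 1 \<le> vnorm V (j \<oplus> x)"
  shows "\<exists>g\<in>annihilator V J. vnorm (dual V) g \<le> 1 \<and> g x = 1"
proof -
  note subJ = submoduleE[OF J, simplified]
  have Jc: "j \<in> carrier V" if "j \<in> J" for j using that subJ(1) by blast
  have zJ: "\<zero> \<in> J" using subJ(2) subJ(4)[of _ 0] Jc by force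
  have key: "norm c \<le> vnorm V (j \<oplus> c \<odot> x)" if j: "j \<in> J" for c j
  proof (cases "c = 0")
    case True
    then show ?thesis using vnorm_nonneg x Jc[OF j] by simp
  next
    case False
    have "c \<odot> ((1 / c) \<odot> j \<oplus> x) = j \<oplus> c \<odot> x"
      using False x Jc[OF j] by (simp add: smult_add_right smult_smult)
    then have "vnorm V (j \<oplus> c \<odot> x) = norm c * vnorm V ((1 / c) \<odot> j \<oplus> x)"
      using x Jc[OF j] vnorm_smult[of "(1 / c) \<odot> j \<oplus> x" c] by simp
    then show ?thesis
      using mult_left_mono[OF far[OF subJ(4)[OF j, of "1 / c"]] norm_ge_zero[of c]] by simp
  qed
  have unique: "c = d" if jk: "j \<in> J" "k \<in> J" and eq: "j \<oplus> c \<odot> x = k \<oplus> d \<odot> x" for j k c d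
  proof -
    have "(j \<oplus> (- 1) \<odot> k) \<oplus> (c - d) \<odot> x = (j \<oplus> c \<odot> x) \<oplus> (- 1) \<odot> (k \<oplus> d \<odot> x)"
      using x Jc jk smult_add_left[OF x, of c "- d"]
      by (simp add: smult_add_right smult_smult a_ac)
    also have "\<dots> = \<zero>" using eq x Jc jk by (simp add: add_uminus)
    finally show ?thesis
      using key[of "j \<oplus> (- 1) \<odot> k" "c - d"] subJ jk by simp
  qed
  define S where "S = {j \<oplus> c \<odot> x | j c. j \<in> J}"
  define f where "f = (\<lambda>s. THE c. \<exists>j\<in>J. s = j \<oplus> c \<odot> x)"
  have f_eq: "f (j \<oplus> c \<odot> x) = c" if "j \<in> J" for j c
    unfolding f_def by (rule the_equality) (use that unique in blast)+
  have S_add: "(j \<oplus> c \<odot> x) \<oplus> (k \<oplus> d \<odot> x) = (j \<oplus> k) \<oplus> (c + d) \<odot> x" if "j \<in> J" "k \<in> J" for j k c d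
    using that Jc x by (simp add: smult_add_left a_ac)
  have S_scale: "c \<odot> (j \<oplus> d \<odot> x) = c \<odot> j \<oplus> (c * d) \<odot> x" if "j \<in> J" for j c d
    using that Jc x by (simp add: smult_add_right smult_smult)
  obtain g where g: "linear_map V (scalars :: ('k, 'k) normed_module) g" "\<And>s. s \<in> S \<Longrightarrow> g s = f s"
      "\<And>y. y \<in> carrier V \<Longrightarrow> norm (g y) \<le> vnorm V y"
  proof (rule Hahn_Banach[of "vnorm V" S f])
    show "S \<subseteq> carrier V" using x Jc by (auto simp: S_def)
    show "\<zero> \<in> S" using zJ x by (auto simp: S_def intro!: exI[of _ "\<zero>"] exI[of _ 0])
    show "y \<oplus> z \<in> S" "f (y \<oplus> z) = f y + f z" if yz: "y \<in> S" "z \<in> S" for y z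
    proof -
      obtain j k c d where jk: "j \<in> J" "k \<in> J" "y = j \<oplus> c \<odot> x" "z = k \<oplus> d \<odot> x"
        using yz unfolding S_def by blast
      then show "y \<oplus> z \<in> S" "f (y \<oplus> z) = f y + f z"
        using subJ(5)[of j k] f_eq S_add[of j k c d] by (auto simp: S_def)
    qed
    show "c \<odot> y \<in> S" "f (c \<odot> y) = c * f y" if y: "y \<in> S" for c y
    proof -
      obtain j d where j: "j \<in> J" "y = j \<oplus> d \<odot> x" using y unfolding S_def by blast
      then show "c \<odot> y \<in> S" "f (c \<odot> y) = c * f y"
        using subJ(4)[of j c] f_eq S_scale[of j c d] by (auto simp: S_def)
    qed
    show "norm (f y) \<le> vnorm V y" if "y \<in> S" for y
      using that key f_eq by (auto simp: S_def)
  qed (auto simp: vnorm_triangle vnorm_smult)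
  have "g j = 0" if "j \<in> J" for j
  proof -
    have "j = j \<oplus> 0 \<odot> x" using x Jc[OF that] by simp
    then show ?thesis using f_eq[OF that, of 0] g(2)[of j] that by (force simp: S_def)
  qed
  moreover have "g x = 1"
  proof -
    have "\<zero> \<oplus> 1 \<odot> x \<in> S" using zJ unfolding S_def by blast
    then show ?thesis using f_eq[OF zJ, of 1] g(2)[of "\<zero> \<oplus> 1 \<odot> x"] x by simp
  qed
  moreover have "restrict g (carrier V) \<in> carrier (dual V)"
    by (rule restrict_in_dual[where B = 1]) (use linear_mapD[OF g(1)] g(3) in auto)
  moreover have "vnorm (dual V) (restrict g (carrier V)) \<le> 1"
    by (rule dual_norm_leI) (use g(3) in auto)
  ultimately show ?thesis
    using x Jc by (intro bexI[of _ "restrict g (carrier V)"]) (auto simp: annihilator_def)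
qed

end

section \<open>L-projections and smooth points\<close>

context normed_space
begin

definition supports :: "('v \<Rightarrow> 'k) \<Rightarrow> 'v \<Rightarrow> bool" where
  "supports f x \<longleftrightarrow> f \<in> carrier (dual V) \<and> vnorm (dual V) f = 1 \<and> f x = 1"

lemma supportsI:
  assumes "x \<in> carrier V" "vnorm V x \<le> 1"
    and f: "f \<in> carrier (dual V)" "vnorm (dual V) f \<le> 1" "f x = 1"
  shows "supports f x"
  using dual_norm_upper[OF f(1) assms(1,2)] f by (simp add: supports_def)

lemma smooth_point_iff:
  "smooth_point V x \<longleftrightarrow> x \<in> carrier V \<and> vnorm V x = 1 \<and> (\<exists>!f. supports f x)"
  by (simp add: smooth_point_def supports_def)

end

text \<open>The equality case of the triangle inequality for a splitting of the scalar one.\<close>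

lemma part_of_unit_eq:
  fixes u v :: "'k::real_or_complex"
  assumes "norm u \<le> a" "norm v \<le> b" "u + v = 1" "a + b \<le> 1"
  shows "u = of_real a"
proof -
  obtain h :: "'k \<Rightarrow> complex" where h: "h 1 = 1" "\<And>r a. h (r *\<^sub>R a) = r *\<^sub>R h a"
      "\<And>a b. h (a + b) = h a + h b" "\<And>a. norm (h a) = norm a"
    using isometric_embedding_into_complex by metis
  have "Re (h u) + Re (h v) = 1" using assms(3) h(1,3) by (metis one_complex.simps(1) plus_complex.simps(1))
  then have Re: "Re (h u) = a" "norm (h u) \<le> Re (h u)"
    using complex_Re_le_cmod[of "h u"] complex_Re_le_cmod[of "h v"] assms h(4)[of u] h(4)[of v]
    by linarith+
  have "(Im (h u))\<^sup>2 \<le> 0"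
    using cmod_power2[of "h u"] power_mono[OF Re(2) norm_ge_zero, of 2] by linarith
  then have "h u = of_real a" using Re(1) by (simp add: complex_eq_iff)
  moreover have "h (of_real a) = of_real a"
    using h(2)[of a 1] h(1) by (simp add: of_real_def)
  moreover have "h (u - of_real a) + h (of_real a) = h u"
    using h(3)[of "u - of_real a" "of_real a"] by simp
  ultimately show ?thesis using h(4)[of "u - of_real a"] by simp
qed

definition L_projection :: "('k::real_or_complex, 'v, 'm) normed_module_scheme \<Rightarrow> ('v \<Rightarrow> 'v) \<Rightarrow> bool" where
  "L_projection V P \<longleftrightarrow> linear_map V V P \<and> (\<forall>x\<in>carrier V. P (P x) = P x) \<and>
     (\<forall>x\<in>carrier V. vnorm V (P x) + vnorm V (x \<ominus>\<^bsub>V\<^esub> P x) = vnorm V x)"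

context normed_space
begin

lemma L_projection_dual_iff:
  "L_projection (dual V) P \<longleftrightarrow> linear_map (dual V) (dual V) P \<and>
     (\<forall>f\<in>carrier (dual V). P (P f) = P f) \<and>
     (\<forall>f\<in>carrier (dual V). vnorm (dual V) (P f) +
        vnorm (dual V) (f \<oplus>\<^bsub>dual V\<^esub> (- 1) \<odot>\<^bsub>dual V\<^esub> P f) = vnorm (dual V) f)"
proof (cases "linear_map (dual V) (dual V) P")
  case True
  then show ?thesis
    by (simp add: L_projection_def dual_minus_eq linear_mapD(1))
qed (simp add: L_projection_def)

lemma L_projection_contraction:
  assumes "L_projection (dual V) P"
  shows "contraction (dual V) (dual V) P"
  unfolding contraction_def
proof (intro conjI ballI)
  show lin: "linear_map (dual V) (dual V) P" using assms by (simp add: L_projection_def)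
  interpret D: normed_space "dual V" by (rule normed_space_dual)
  fix f assume f: "f \<in> carrier (dual V)"
  have "0 \<le> vnorm (dual V) (f \<oplus>\<^bsub>dual V\<^esub> (- 1) \<odot>\<^bsub>dual V\<^esub> P f)"
    using linear_mapD(1)[OF lin f] f by (intro D.vnorm_nonneg) simp
  then show "vnorm (dual V) (P f) \<le> vnorm (dual V) f"
    using assms f unfolding L_projection_dual_iff by fastforce
qed

text \<open>
  If \<open>P f\<close> is not zero, then the equality case of the triangle inequality, applied to
  \<open>f = P f + (f - P f)\<close> at \<open>x\<close>, shows that the normalized part \<open>P f\<close> also supports \<open>x\<close>. By smoothness
  \<open>P f = a f\<close> for some \<open>a > 0\<close>, and \<open>P (P f) = P f\<close> forces \<open>a = 1\<close>.
\<close>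

lemma smooth_support_dichotomy:
  assumes smooth: "smooth_point V x" and f: "supports f x" and P: "L_projection (dual V) P"
  shows "P f = f \<or> P f = \<zero>\<^bsub>dual V\<^esub>"
proof -
  interpret D: normed_space "dual V" by (rule normed_space_dual)
  have x: "x \<in> carrier V" "vnorm V x = 1" using smooth by (simp_all add: smooth_point_def)
  have fD: "f \<in> carrier (dual V)" and f1: "vnorm (dual V) f = 1" "f x = 1"
    using f by (simp_all add: supports_def)
  note lin = contractionD[OF L_projection_contraction[OF P]]
  define a where "a = vnorm (dual V) (P f)"
  define r where "r = f \<oplus>\<^bsub>dual V\<^esub> (- 1) \<odot>\<^bsub>dual V\<^esub> P f"
  have Pf: "P f \<in> carrier (dual V)" and rD: "r \<in> carrier (dual V)"
    using lin(1)[OF fD] fD by (simp_all add: r_def)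
  have "P f x = of_real a"
  proof (rule part_of_unit_eq)
    show "norm (P f x) \<le> a" "norm (r x) \<le> vnorm (dual V) r"
      using dual_norm_upper[OF Pf] dual_norm_upper[OF rD] x by (simp_all add: a_def)
    show "a + vnorm (dual V) r \<le> 1"
      using P fD f1 by (simp add: L_projection_dual_iff a_def r_def)
  qed (use x f1 in \<open>simp add: r_def\<close>)
  show ?thesis
  proof (cases "a = 0")
    case True
    then show ?thesis using D.vnorm_eq_0_iff[OF Pf] by (simp add: a_def)
  next
    case False
    then have a: "0 < a" using dual_norm_nonneg[OF Pf] by (simp add: a_def)
    have "supports (of_real (1 / a) \<odot>\<^bsub>dual V\<^esub> P f) x"
      using x Pf a \<open>P f x = of_real a\<close>
      by (intro supportsI) (simp_all add: D.vnorm_smult norm_divide flip: a_def)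
    then have "of_real (1 / a) \<odot>\<^bsub>dual V\<^esub> P f = f"
      using smooth f unfolding smooth_point_iff by blast
    then have "of_real a \<odot>\<^bsub>dual V\<^esub> f = P f"
      using D.smult_smult[OF Pf, of "of_real a" "of_real (1 / a)"] a Pf by simp
    moreover from this have "P f = of_real a \<odot>\<^bsub>dual V\<^esub> P f"
      using lin(4)[OF fD, of "of_real a"] P fD by (simp add: L_projection_def)
    then have "a = a * a"
      using D.vnorm_smult[OF Pf, of "of_real a"] a by (simp flip: a_def)
    then have "a = 1" using a by simp
    ultimately show ?thesis using fD by auto
  qed
qed

text \<open>
  Functionals on the quotient correspond to functionals annihilating \<open>J\<close>. The supporting functional
  of \<open>x\<close> descends to the quotient and shows that the coset still has norm one; any other functional
  supporting the coset pulls back to a functional supporting \<open>x\<close>.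
\<close>

lemma quotient_smooth_point:
  assumes J: "submodule J (scalars :: ('k, 'k) normed_module) V" 
    and smooth: "smooth_point V x" and f: "supports f x" and ann: "\<And>j. j \<in> J \<Longrightarrow> f j = 0"
  shows "smooth_point (quotient_space V J) (J +> x)"
proof -
  note subJ = submoduleE[OF J, simplified]
  have Jc: "j \<in> carrier V" if "j \<in> J" for j using that subJ(1) by blast
  have zJ: "\<zero> \<in> J" using subJ(2) subJ(4)[of _ 0] Jc by force
  have "additive_subgroup J V"
    using J by (intro additive_subgroup.intro) (simp add: submodule_def)
  then interpret J: abelian_subgroup J V
    by (rule abelian_subgroupI3) (rule abelian_group_axioms)
  define Q where "Q = quotient_space V J"
  have Q_sel: "carrier Q = a_rcosets J" "vnorm Q A = (INF y\<in>A. vnorm V y)"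
      "add Q A B = A <+> B" "smult Q c A = J <+> ((\<lambda>x. c \<odot> x) ` A)" for A B c
    by (simp_all add: Q_def quotient_space_def)
  have x: "x \<in> carrier V" "vnorm V x = 1" using smooth by (simp_all add: smooth_point_def)
  have fD: "f \<in> carrier (dual V)" and f1: "vnorm (dual V) f = 1" "f x = 1"
    using f by (simp_all add: supports_def)
  have mem: "y \<in> J +> a \<longleftrightarrow> (\<exists>j\<in>J. y = j \<oplus> a)" for y a
    by (auto simp: a_r_coset_def')
  have self: "a \<in> J +> a" if "a \<in> carrier V" for a
    by (rule J.a_rcos_self[OF that])
  have cosets: "A \<in> carrier Q \<longleftrightarrow> (\<exists>a\<in>carrier V. A = J +> a)" for A
    by (auto simp: Q_sel A_RCOSETS_def')
  have coset_sub: "J +> a \<subseteq> carrier V" if "a \<in> carrier V" for a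
    using that Jc by (auto simp: mem)
  have Q_add: "add Q (J +> a) (J +> b) = J +> (a \<oplus> b)" if "a \<in> carrier V" "b \<in> carrier V" for a b
    using that by (simp add: Q_sel J.a_rcos_sum)
  have Q_smult: "smult Q c (J +> a) = J +> (c \<odot> a)" if a: "a \<in> carrier V" for a c
  proof (intro Set.set_eqI iffI)
    fix y assume "y \<in> smult Q c (J +> a)"
    then obtain j k where jk: "j \<in> J" "k \<in> J" "y = j \<oplus> c \<odot> (k \<oplus> a)"
      by (auto simp: Q_sel set_add_def' mem)
    then have "y = (j \<oplus> c \<odot> k) \<oplus> c \<odot> a" using a Jc by (simp add: smult_add_right a_assoc)
    then show "y \<in> J +> (c \<odot> a)" using jk subJ(5)[OF jk(1) subJ(4)[OF jk(2)]] unfolding mem by blast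
  next
    fix y assume "y \<in> J +> (c \<odot> a)"
    then obtain j where j: "j \<in> J" "y = j \<oplus> c \<odot> a" unfolding mem by blast
    have "c \<odot> a \<in> (\<lambda>x. c \<odot> x) ` (J +> a)" using self[OF a] by (rule imageI)
    then show "y \<in> smult Q c (J +> a)"
      unfolding Q_sel set_add_def' j(2) using j(1) by blast
  qed
  have Q_norm_le: "vnorm Q A \<le> vnorm V y" if "A \<in> carrier Q" "y \<in> A" for A y
  proof -
    have "\<And>z. z \<in> A \<Longrightarrow> 0 \<le> vnorm V z" using that cosets coset_sub vnorm_nonneg by blast
    then show ?thesis unfolding Q_sel by (intro cINF_lower bdd_belowI2[where m = 0] that)
  qed
  have Q_norm_ge: "c \<le> vnorm Q A" if "A \<in> carrier Q" "\<And>y. y \<in> A \<Longrightarrow> c \<le> vnorm V y" for c A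
  proof -
    have "A \<noteq> {}" using that(1) cosets self by blast
    then show ?thesis unfolding Q_sel by (rule cINF_greatest) (rule that(2))
  qed
  have f_coset: "f y = f a" if "a \<in> carrier V" "y \<in> J +> a" for a y
    using that ann Jc dual_linear(1)[OF fD] by (auto simp: mem)
  have f_norm: "norm (f y) \<le> vnorm V y" if "y \<in> carrier V" for y
    using dual_norm_bound[OF fD that] f1 by simp
  define F where "F = (\<lambda>A\<in>carrier Q. f (SOME y. y \<in> A))"
  have F_eq: "F (J +> a) = f a" if a: "a \<in> carrier V" for a
    using f_coset[OF a someI[of "\<lambda>y. y \<in> J +> a"], OF self[OF a]] a cosets by (auto simp: F_def)
  have F_norm: "norm (F A) \<le> vnorm Q A" if A: "A \<in> carrier Q" for A
  proof (rule Q_norm_ge[OF A])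
    obtain a where a: "a \<in> carrier V" "A = J +> a" using A cosets by blast
    fix y assume "y \<in> A"
    then show "norm (F A) \<le> vnorm V y"
      using a F_eq f_coset[of a y] f_norm[of y] coset_sub by fastforce
  qed
  have xQ: "J +> x \<in> carrier Q" using x cosets by blast
  have x_norm: "vnorm Q (J +> x) = 1"
  proof (rule antisym)
    show "vnorm Q (J +> x) \<le> 1" using Q_norm_le[OF xQ self] x by simp
    show "1 \<le> vnorm Q (J +> x)" using F_norm[OF xQ] F_eq f1 x by simp
  qed
  have dual_Q_norm: "vnorm (dual Q) G = (SUP A\<in>{A \<in> carrier Q. vnorm Q A \<le> 1}. norm (G A))" for G
    by (simp add: dual_def)
  have F_dual: "F \<in> carrier (dual Q)"
    unfolding in_dual_iff linear_map_def
  proof (intro conjI ballI allI funcsetI exI[of _ 1])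
    show "F \<in> extensional (carrier Q)" by (simp add: F_def)
    fix A B c assume "A \<in> carrier Q" 
    then obtain a where a: "a \<in> carrier V" "A = J +> a" using cosets by blast
    show "F (smult Q c A) = smult scalars c (F A)"
      using a by (simp add: Q_smult F_eq dual_linear[OF fD])
    assume "B \<in> carrier Q"
    then obtain b where "b \<in> carrier V" "B = J +> b" using cosets by blast
    then show "F (add Q A B) = add scalars (F A) (F B)"
      using a by (simp add: Q_add F_eq dual_linear[OF fD])
  qed (use F_norm in simp_all)
  have "vnorm (dual Q) F = 1"
    unfolding dual_Q_norm
  proof (rule antisym)
    have le1: "norm (F A) \<le> 1" if "A \<in> {A \<in> carrier Q. vnorm Q A \<le> 1}" for A
      using F_norm[of A] that by simp
    have in_ball: "J +> x \<in> {A \<in> carrier Q. vnorm Q A \<le> 1}" using xQ x_norm by simp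
    show "(SUP A\<in>{A \<in> carrier Q. vnorm Q A \<le> 1}. norm (F A)) \<le> 1"
      by (rule cSUP_least) (use le1 in_ball in blast)+
    have "norm (F (J +> x)) \<le> (SUP A\<in>{A \<in> carrier Q. vnorm Q A \<le> 1}. norm (F A))"
      by (rule cSUP_upper[where f = "\<lambda>A. norm (F A)"])
        (use in_ball le1 in \<open>auto intro!: bdd_aboveI2[where M = 1]\<close>)
    then show "1 \<le> (SUP A\<in>{A \<in> carrier Q. vnorm Q A \<le> 1}. norm (F A))"
      using F_eq x f1 by simp
  qed
  moreover have "G = F" if G: "G \<in> carrier (dual Q)" "vnorm (dual Q) G = 1" "G (J +> x) = 1" for G
  proof -
    define g where "g = (\<lambda>a\<in>carrier V. G (J +> a))"
    obtain B where B: "\<And>A. A \<in> carrier Q \<Longrightarrow> norm (G A) \<le> B * vnorm Q A"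
      using G(1) by (auto simp: in_dual_iff)
    have *: "norm (G A) \<le> \<bar>B\<bar>" if A: "A \<in> carrier Q" "vnorm Q A \<le> 1" for A
    proof -
      have "0 \<le> vnorm Q A"
        by (rule Q_norm_ge[OF A(1)]) (use A(1) cosets coset_sub vnorm_nonneg in blast)
      then have "B * vnorm Q A \<le> \<bar>B\<bar> * 1"
        by (intro mult_mono) (use A in auto)
      then show ?thesis using B[OF A(1)] by simp
    qed
    have G_le: "norm (G A) \<le> 1" if "A \<in> carrier Q" "vnorm Q A \<le> 1" for A
    proof -
      have "norm (G A) \<le> (SUP A\<in>{A \<in> carrier Q. vnorm Q A \<le> 1}. norm (G A))"
        by (rule cSUP_upper[where f = "\<lambda>A. norm (G A)"])
          (use that * in \<open>auto intro!: bdd_aboveI2[where M = "\<bar>B\<bar>"]\<close>)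
      then show ?thesis using G(2) by (simp add: dual_Q_norm)
    qed
    have aQ: "J +> a \<in> carrier Q" if "a \<in> carrier V" for a using that cosets by blast
    have G_add: "G (J +> (a \<oplus> b)) = G (J +> a) + G (J +> b)" if "a \<in> carrier V" "b \<in> carrier V" for a b
      using dual_linear(1)[OF G(1) aQ aQ] Q_add that by simp
    have G_smult: "G (J +> (c \<odot> a)) = c * G (J +> a)" if "a \<in> carrier V" for a c
      using dual_linear(2)[OF G(1) aQ] Q_smult that by simp
    have g_le: "norm (G (J +> a)) \<le> 1 * vnorm V a" if a: "a \<in> carrier V" for a
    proof (rule norm_le_if_unit_ball[OF G_smult _ a])
      fix y assume y: "y \<in> carrier V" "vnorm V y \<le> 1"
      show "norm (G (J +> y)) \<le> 1"
        using G_le[OF aQ[OF y(1)]] Q_norm_le[OF aQ[OF y(1)] self[OF y(1)]] y(2) by linarith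
    qed
    have "g \<in> carrier (dual V)"
      unfolding g_def by (rule restrict_in_dual[OF G_add G_smult g_le])
    moreover have "vnorm (dual V) g \<le> 1"
      by (rule dual_norm_leI) (use g_le in \<open>auto simp: g_def\<close>)
    ultimately have "supports g x"
      using x G by (intro supportsI) (simp_all add: g_def)
    then have "g = f" using smooth f unfolding smooth_point_iff by blast
    then have "G (J +> a) = F (J +> a)" if "a \<in> carrier V" for a
      using that F_eq by (auto simp: g_def)
    then show ?thesis
      using cosets by (intro dual_eqI[OF G(1) F_dual]) auto
  qed
  moreover have "F (J +> x) = 1" using F_eq x f1 by simp
  ultimately show ?thesis
    unfolding smooth_point_def Q_def[symmetric]
    by (intro conjI ex1I[of _ F]) (simp_all only: xQ x_norm F_dual)
qed

end

section \<open>Functionals on biduals and M-ideals\<close>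

context normed_space
begin

text \<open>
  The adjoint of an L-projection decomposes the bidual as a maximum-norm sum of the ranges of
  \<open>P\<^sup>*\<close> and \<open>I - P\<^sup>*\<close>. The hypothesis \<open>near\<close> says that the component of \<open>x\<close> in the second summand has
  norm at most \<open>a < 1\<close>, so \<open>x\<close> can be moved a little in every direction of that summand without
  leaving the unit ball. Since \<open>F\<close> attains its norm at \<open>x\<close>, it has to vanish on that summand.
\<close>

lemma bidual_support_factors_through_L_projection:
  assumes x: "x \<in> carrier V" "vnorm V x \<le> 1" and P: "L_projection (dual V) P" and a: "0 \<le> a" "a < 1"
    and near: "\<And>g. g \<in> carrier (dual V) \<Longrightarrow>
      norm (g x - P g x) \<le> a * vnorm (dual V) (g \<oplus>\<^bsub>dual V\<^esub> (- 1) \<odot>\<^bsub>dual V\<^esub> P g)"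
    and F: "F \<in> carrier (dual (dual (dual V)))" "vnorm (dual (dual (dual V))) F \<le> 1"
      "F (bidual_embedding V x) = 1"
    and \<phi>: "\<phi> \<in> carrier (dual (dual V))"
  shows "F (dual_adjoint (dual V) P \<phi>) = F \<phi>"
proof -
  interpret D: normed_space "dual V" by (rule normed_space_dual)
  interpret DD: normed_space "dual (dual V)" by (rule D.normed_space_dual)
  note P_contr = L_projection_contraction[OF P]
  note P_lin = contractionD[OF P_contr]
  define \<phi>P where "\<phi>P = dual_adjoint (dual V) P \<phi>"
  have \<phi>P: "\<phi>P \<in> carrier (dual (dual V))"
    unfolding \<phi>P_def
    using contraction_dual_adjoint[OF normed_space_dual normed_space_dual P_contr] \<phi>
    by (rule contractionD(1))
  define \<delta> where "\<delta> = F \<phi> - F \<phi>P"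
  define N where "N = vnorm (dual (dual V)) \<phi>"
  have N: "0 \<le> N" using D.dual_norm_nonneg[OF \<phi>] by (simp add: N_def)
  \<comment> \<open>The step length: \<open>t \<phi>\<close> has norm at most \<open>1 - a\<close>, and \<open>N + 1\<close> avoids a division by zero.\<close>
  define t where "t = (1 - a) / (N + 1)"
  have t: "0 < t" "t * N \<le> 1 - a"
    using a N by (simp_all add: t_def field_simps)
  define \<psi> where "\<psi> = \<phi> \<oplus>\<^bsub>dual (dual V)\<^esub> (- 1) \<odot>\<^bsub>dual (dual V)\<^esub> \<phi>P"
  have \<psi>: "\<psi> \<in> carrier (dual (dual V))" using \<phi> \<phi>P by (simp add: \<psi>_def)
  have F\<psi>: "F \<psi> = \<delta>"
    using \<phi> \<phi>P by (simp add: \<psi>_def \<delta>_def dual_linear[OF F(1)])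
  have "\<delta> = 0"
  proof (rule ccontr)
    assume "\<delta> \<noteq> 0"
    \<comment> \<open>The rotation that makes the step increase \<open>F\<close>.\<close>
    define c where "c = of_real (norm \<delta>) / \<delta>"
    have c: "norm c = 1" "c * \<delta> = of_real (norm \<delta>)"
      using \<open>\<delta> \<noteq> 0\<close> by (simp_all add: c_def norm_divide)
    define \<theta> where "\<theta> = bidual_embedding V x \<oplus>\<^bsub>dual (dual V)\<^esub> (of_real t * c) \<odot>\<^bsub>dual (dual V)\<^esub> \<psi>"
    have xh: "bidual_embedding V x \<in> carrier (dual (dual V))"
      by (rule contractionD(1)[OF contraction_bidual_embedding x(1)])
    have \<theta>: "\<theta> \<in> carrier (dual (dual V))" using xh \<psi> by (simp add: \<theta>_def)
    have "norm (\<theta> g) \<le> 1 * vnorm (dual V) g" if g: "g \<in> carrier (dual V)" for g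
    proof -
      define r where "r = g \<oplus>\<^bsub>dual V\<^esub> (- 1) \<odot>\<^bsub>dual V\<^esub> P g"
      have Pg: "P g \<in> carrier (dual V)" using P_lin(1)[OF g] .
      have r: "r \<in> carrier (dual V)" using g Pg by (simp add: r_def)
      have "\<psi> g = \<phi> r"
        using g Pg by (simp add: \<psi>_def \<phi>P_def r_def dual_linear[OF \<phi>])
      then have "\<theta> g = P g x + ((g x - P g x) + of_real t * (c * \<phi> r))"
        using g by (simp add: \<theta>_def)
      then have "norm (\<theta> g) \<le>
          norm (P g x) + (norm (g x - P g x) + norm (of_real t * (c * \<phi> r)))"
        by (metis norm_triangle_ineq norm_triangle_le add_left_mono order_trans)
      moreover have "norm (P g x) \<le> vnorm (dual V) (P g)"
        by (rule dual_norm_upper[OF Pg x])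
      moreover have "norm (g x - P g x) \<le> a * vnorm (dual V) r"
        using near[OF g] by (simp add: r_def)
      moreover have "norm (of_real t * (c * \<phi> r)) \<le> (1 - a) * vnorm (dual V) r"
      proof -
        have "norm (of_real t * (c * \<phi> r)) = t * norm (\<phi> r)"
          using t c by (simp add: norm_mult)
        also have "\<dots> \<le> t * (N * vnorm (dual V) r)"
          using D.dual_norm_bound[OF \<phi> r] t by (simp add: N_def)
        also have "\<dots> \<le> (1 - a) * vnorm (dual V) r"
          using mult_right_mono[OF t(2) dual_norm_nonneg[OF r]] by (simp add: mult.assoc)
        finally show ?thesis .
      qed
      moreover have "vnorm (dual V) (P g) + vnorm (dual V) r = vnorm (dual V) g"
        using P g unfolding L_projection_dual_iff r_def by blast
      ultimately show ?thesis by (simp add: algebra_simps)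
    qed
    then have "vnorm (dual (dual V)) \<theta> \<le> 1" by (intro D.dual_norm_leI) simp_all
    then have "norm (F \<theta>) \<le> 1"
      using DD.dual_norm_upper[OF F(1) \<theta>] F(2) by linarith
    moreover have "F \<theta> = of_real (1 + t * norm \<delta>)"
      using xh \<psi> c F(3) F\<psi> by (simp add: \<theta>_def dual_linear[OF F(1)] mult.assoc)
    ultimately have "\<bar>1 + t * norm \<delta>\<bar> \<le> 1" by (simp only: norm_of_real)
    then show False using mult_pos_pos[OF t(1), of "norm \<delta>"] \<open>\<delta> \<noteq> 0\<close> by simp
  qed
  then show ?thesis by (simp add: \<delta>_def \<phi>P_def)
qed

lemma contraction_inclusion: "J \<subseteq> carrier V \<Longrightarrow> contraction (V\<lparr>carrier := J\<rparr>) V (\<lambda>x. x)"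
  by (auto simp: contraction_def linear_map_def)

text \<open>
  Two functionals that agree on \<open>J\<close> differ by an element of the kernel, so \<open>P g\<close> depends only on the
  restriction of \<open>g\<close> to \<open>J\<close>. The factor \<open>E\<close> applies \<open>P\<close> to any norm preserving extension; its adjoint
  later lifts functionals on the dual of \<open>V\<close> to the bidual of \<open>J\<close>.
\<close>

lemma L_projection_factors_through_restriction:
  assumes J: "J \<subseteq> carrier V" and VJ: "normed_space (V\<lparr>carrier := J\<rparr>)"
    and P: "L_projection (dual V) P"
    and ker: "{f \<in> carrier (dual V). P f = \<zero>\<^bsub>dual V\<^esub>} = annihilator V J"
  shows "\<exists>E. contraction (dual (V\<lparr>carrier := J\<rparr>)) (dual V) E \<and>
    (\<forall>g\<in>carrier (dual V). E (dual_adjoint (V\<lparr>carrier := J\<rparr>) (\<lambda>x. x) g) = P g)"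
proof -
  let ?J = "V\<lparr>carrier := J\<rparr>"
  interpret S: normed_space ?J by (rule VJ)
  interpret D: normed_space "dual V" by (rule normed_space_dual)
  interpret DS: normed_space "dual ?J" by (rule S.normed_space_dual)
  note lin = contractionD[OF L_projection_contraction[OF P]]
  note res = contractionD[OF contraction_dual_adjoint[OF VJ normed_space_axioms contraction_inclusion[OF J]]]
  have determined: "P f = P g"
    if f: "f \<in> carrier (dual V)" and g: "g \<in> carrier (dual V)" and eq: "\<And>x. x \<in> J \<Longrightarrow> f x = g x" for f g
  proof -
    have "f \<oplus>\<^bsub>dual V\<^esub> (- 1) \<odot>\<^bsub>dual V\<^esub> g \<in> annihilator V J"
      using f g J eq by (auto simp: annihilator_def subset_iff)
    then have "P f \<oplus>\<^bsub>dual V\<^esub> (- 1) \<odot>\<^bsub>dual V\<^esub> P g = \<zero>\<^bsub>dual V\<^esub>"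
      using f g lin(3)[of f "(- 1) \<odot>\<^bsub>dual V\<^esub> g"] lin(4)[OF g] unfolding ker[symmetric] by simp
    then have "P f x = P g x" if "x \<in> carrier V" for x
      using dual_apply[OF that] by (metis add.right_neutral diff_add_cancel mult_minus1 uminus_add_conv_diff add.commute)
    then show ?thesis using lin(1) f g by (intro dual_eqI[of _ V]) auto
  qed
  define ext where "ext = (\<lambda>h. SOME g. g \<in> carrier (dual V) \<and>
      vnorm (dual V) g \<le> vnorm (dual ?J) h \<and> (\<forall>x\<in>J. g x = h x))"
  have ext: "ext h \<in> carrier (dual V)" "vnorm (dual V) (ext h) \<le> vnorm (dual ?J) h"
      "\<And>x. x \<in> J \<Longrightarrow> ext h x = h x" if h: "h \<in> carrier (dual ?J)" for h
  proof -
    have "\<exists>g. g \<in> carrier (dual V) \<and> vnorm (dual V) g \<le> vnorm (dual ?J) h \<and> (\<forall>x\<in>J. g x = h x)"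
      using norm_preserving_extension[OF J VJ h] by blast
    from someI_ex[OF this] show "ext h \<in> carrier (dual V)"
      "vnorm (dual V) (ext h) \<le> vnorm (dual ?J) h" "\<And>x. x \<in> J \<Longrightarrow> ext h x = h x"
      unfolding ext_def by blast+
  qed
  define E where "E = (\<lambda>h. P (ext h))"
  have E_eq: "E h = P g"
    if "h \<in> carrier (dual ?J)" "g \<in> carrier (dual V)" "\<And>x. x \<in> J \<Longrightarrow> g x = h x" for h g
    unfolding E_def by (rule determined) (use ext[OF that(1)] that in auto)
  have "contraction (dual ?J) (dual V) E"
    unfolding contraction_def linear_map_def
  proof (intro conjI ballI allI funcsetI)
    fix h k c assume h: "h \<in> carrier (dual ?J)"
    show "E h \<in> carrier (dual V)" using lin(1) ext(1)[OF h] by (simp add: E_def)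
    show "vnorm (dual V) (E h) \<le> vnorm (dual ?J) h"
      using lin(2)[OF ext(1)[OF h]] ext(2)[OF h] by (simp add: E_def)
    have "E (c \<odot>\<^bsub>dual ?J\<^esub> h) = P (c \<odot>\<^bsub>dual V\<^esub> ext h)"
      by (rule E_eq) (use h ext[OF h] J in \<open>auto simp: subset_iff\<close>)
    then show "E (c \<odot>\<^bsub>dual ?J\<^esub> h) = c \<odot>\<^bsub>dual V\<^esub> E h"
      using lin(4)[OF ext(1)[OF h]] by (simp add: E_def)
    assume k: "k \<in> carrier (dual ?J)"
    have "E (h \<oplus>\<^bsub>dual ?J\<^esub> k) = P (ext h \<oplus>\<^bsub>dual V\<^esub> ext k)"
      by (rule E_eq) (use h k ext[OF h] ext[OF k] J in \<open>auto simp: subset_iff\<close>)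
    then show "E (h \<oplus>\<^bsub>dual ?J\<^esub> k) = E h \<oplus>\<^bsub>dual V\<^esub> E k"
      using lin(3)[OF ext(1)[OF h] ext(1)[OF k]] by (simp add: E_def)
  qed
  moreover have "E (dual_adjoint ?J (\<lambda>x. x) g) = P g" if "g \<in> carrier (dual V)" for g
    by (rule E_eq) (use that res(1) in auto)
  ultimately show ?thesis by blast
qed

end

theorem proposition4:
  fixes X :: "('k::real_or_complex, 'v) normed_module" and J :: "'v set"
  assumes "banach_space X"
    and "banach_space (X\<lparr>carrier := J\<rparr>)" and "Hahn_Banach_smooth (X\<lparr>carrier := J\<rparr>)"
    and "M_ideal J X"
    and "\<not> (\<exists>A. smooth_point (quotient_space X J) A)"
  shows "\<forall>x. smooth_point X x \<longrightarrow> very_smooth_point X x"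
proof (intro allI impI)
  fix x assume smooth: "smooth_point X x"
  let ?J = "X\<lparr>carrier := J\<rparr>"
  interpret X: normed_space X using assms(1) by (simp add: banach_space_def)
  interpret S: normed_space ?J using assms(2) by (simp add: banach_space_def)
  interpret DX: normed_space "dual X" by (rule X.normed_space_dual)
  interpret DDX: normed_space "dual (dual X)" by (rule DX.normed_space_dual)
  interpret DS: normed_space "dual ?J" by (rule S.normed_space_dual)
  interpret DDS: normed_space "dual (dual ?J)" by (rule DS.normed_space_dual)
  have x: "x \<in> carrier X" "vnorm X x = 1" using smooth by (simp_all add: smooth_point_def)
  obtain f where f: "X.supports f x" and f_unique: "\<And>g. X.supports g x \<Longrightarrow> g = f"
    using smooth unfolding X.smooth_point_iff by blast
  have fD: "f \<in> carrier (dual X)" and f1: "vnorm (dual X) f = 1" "f x = 1"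
    using f by (simp_all add: X.supports_def)
  have J: "submodule J (scalars :: ('k, 'k) normed_module) X"
    using assms(4) by (simp add: M_ideal_def closed_subspace_def)
  have Jc: "J \<subseteq> carrier X" using X.submoduleE(1)[OF J] .
  obtain P where P: "L_projection (dual X) P"
    and ker: "{f \<in> carrier (dual X). P f = \<zero>\<^bsub>dual X\<^esub>} = annihilator X J"
    using assms(4) unfolding M_ideal_def L_projection_def by blast
  note P_contr = X.L_projection_contraction[OF P]
  note P_lin = contractionD[OF P_contr]

  \<comment> \<open>A supporting functional in the annihilator would make the coset of \<open>x\<close> a smooth point.\<close>
  have f_not_ann: "f \<notin> annihilator X J"
    using X.quotient_smooth_point[OF J smooth f] assms(5) by (auto simp: annihilator_def)
  then have Pf: "P f = f"
    using X.smooth_support_dichotomy[OF smooth f P] ker fD by auto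

  \<comment> \<open>Otherwise some functional annihilating \<open>J\<close> would support \<open>x\<close>, hence be equal to \<open>f\<close>.\<close>
  obtain j where j: "j \<in> J" "vnorm X (j \<oplus>\<^bsub>X\<^esub> x) < 1"
  proof -
    have "\<not> (\<forall>j\<in>J. 1 \<le> vnorm X (j \<oplus>\<^bsub>X\<^esub> x))"
    proof
      assume "\<forall>j\<in>J. 1 \<le> vnorm X (j \<oplus>\<^bsub>X\<^esub> x)"
      then obtain g where "g \<in> annihilator X J" "vnorm (dual X) g \<le> 1" "g x = 1"
        using X.annihilating_functional[OF J x(1)] by blast
      then show False
        using f_unique[OF X.supportsI[of x g]] x f_not_ann by (auto simp: annihilator_def)
    qed
    then show thesis using that by force
  qed
  have jc: "j \<in> carrier X" using j Jc by blast
  define a where "a = vnorm X (j \<oplus>\<^bsub>X\<^esub> x)"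
  have a: "0 \<le> a" "a < 1" using j jc x by (simp_all add: a_def X.vnorm_nonneg)
  have near: "norm (g x - P g x) \<le> a * vnorm (dual X) (g \<oplus>\<^bsub>dual X\<^esub> (- 1) \<odot>\<^bsub>dual X\<^esub> P g)"
    if g: "g \<in> carrier (dual X)" for g
  proof -
    let ?r = "g \<oplus>\<^bsub>dual X\<^esub> (- 1) \<odot>\<^bsub>dual X\<^esub> P g"
    have Pg: "P g \<in> carrier (dual X)" by (rule P_lin(1)[OF g])
    have r: "?r \<in> carrier (dual X)" using g Pg by simp
    have "P ?r = P g \<oplus>\<^bsub>dual X\<^esub> (- 1) \<odot>\<^bsub>dual X\<^esub> P g"
      using P_lin(3)[OF g, of "(- 1) \<odot>\<^bsub>dual X\<^esub> P g"] P_lin(4)[OF Pg, of "- 1"] P g Pg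
      by (simp add: L_projection_def)
    then have "P ?r = \<zero>\<^bsub>dual X\<^esub>" using DX.add_uminus[OF Pg] by simp
    then have "?r \<in> annihilator X J" using r ker by blast
    then have "?r j = 0" using j by (simp add: annihilator_def)
    then have "g x - P g x = ?r (j \<oplus>\<^bsub>X\<^esub> x)"
      using g jc x by (simp add: dual_linear(1)[OF r jc x(1)])
    then show ?thesis
      using X.dual_norm_bound'[OF r, of "j \<oplus>\<^bsub>X\<^esub> x"] jc x by (simp add: a_def)
  qed

  \<comment> \<open>The iterated adjoints of the inclusion of \<open>J\<close>: restriction of functionals to \<open>J\<close>, the inclusion of
    the bidual of \<open>J\<close>, and restriction of functionals to that bidual.\<close>
  define i1 where "i1 = dual_adjoint ?J (\<lambda>x. x)"
  define i2 where "i2 = dual_adjoint (dual X) i1"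
  define i3 where "i3 = dual_adjoint (dual (dual ?J)) i2"
  have i1: "contraction (dual X) (dual ?J) i1"
    unfolding i1_def
    by (rule contraction_dual_adjoint[OF S.normed_space_axioms X.normed_space_axioms X.contraction_inclusion[OF Jc]])
  have i2: "contraction (dual (dual ?J)) (dual (dual X)) i2"
    unfolding i2_def by (rule contraction_dual_adjoint[OF DX.normed_space_axioms DS.normed_space_axioms i1])
  have i3: "contraction (dual (dual (dual X))) (dual (dual (dual ?J))) i3"
    unfolding i3_def by (rule contraction_dual_adjoint[OF DDS.normed_space_axioms DDX.normed_space_axioms i2])
  obtain E where E: "contraction (dual ?J) (dual X) E"
    and E_eq: "\<And>g. g \<in> carrier (dual X) \<Longrightarrow> E (i1 g) = P g"
    using X.L_projection_factors_through_restriction[OF Jc S.normed_space_axioms P ker]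
    unfolding i1_def by blast
  have i1f: "i1 f \<in> carrier (dual ?J)" by (rule contractionD(1)[OF i1 fD])
  have i1f_norm: "1 \<le> vnorm (dual ?J) (i1 f)"
    using contractionD(2)[OF E i1f] E_eq[OF fD] Pf f1 by simp

  define xh where "xh = bidual_embedding X x"
  have xh: "xh \<in> carrier (dual (dual X))" "vnorm (dual (dual X)) xh \<le> 1"
    using contractionD(1,2)[OF X.contraction_bidual_embedding x(1)] x(2) by (simp_all add: xh_def)
  have xh_norm: "vnorm (dual (dual X)) xh = 1"
    using DX.dual_norm_bound[OF xh(1) fD] xh(2) f1 fD by (simp add: xh_def)

  \<comment> \<open>Every \<open>F\<close> supporting \<open>x\<close> in the bidual restricts to a norm preserving extension of \<open>f\<close> from \<open>J\<close> to its
    bidual: on \<open>X\<close> it is a functional supporting \<open>x\<close>, hence \<open>f\<close>.\<close>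
  have i3_eq: "i3 F \<in> carrier (dual (dual (dual ?J))) \<and>
      vnorm (dual (dual (dual ?J))) (i3 F) = vnorm (dual ?J) (i1 f) \<and>
      (\<forall>y\<in>carrier ?J. i3 F (bidual_embedding ?J y) = i1 f y)"
    if F: "DDX.supports F xh" for F
  proof -
    have FD: "F \<in> carrier (dual (dual (dual X)))" "vnorm (dual (dual (dual X))) F = 1" "F xh = 1"
      using F by (simp_all add: DDX.supports_def)
    let ?g = "dual_adjoint X (bidual_embedding X) F"
    have g: "?g \<in> carrier (dual X)" "vnorm (dual X) ?g \<le> 1"
      using contractionD(1,2)[OF contraction_dual_adjoint[OF X.normed_space_axioms DDX.normed_space_axioms
            X.contraction_bidual_embedding] FD(1)] FD(2) by simp_all
    have "?g = f"
      by (rule f_unique) (rule X.supportsI, use x g FD in \<open>simp_all add: xh_def\<close>)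
    then have F_f: "F (bidual_embedding X y) = f y" if "y \<in> carrier X" for y
      using dual_adjoint_apply[OF that, of "bidual_embedding X" F] by simp
    have ext: "i3 F (bidual_embedding ?J y) = i1 f y" if y: "y \<in> J" for y
    proof -
      have yh: "bidual_embedding ?J y \<in> carrier (dual (dual ?J))"
        using contractionD(1)[OF S.contraction_bidual_embedding] y by simp
      have "i2 (bidual_embedding ?J y) = bidual_embedding X y"
      proof (rule dual_eqI[of _ "dual X"])
        show "i2 (bidual_embedding ?J y) \<in> carrier (dual (dual X))"
          by (rule contractionD(1)[OF i2 yh])
        show "bidual_embedding X y \<in> carrier (dual (dual X))"
          using contractionD(1)[OF X.contraction_bidual_embedding] y Jc by blast
        fix g assume g: "g \<in> carrier (dual X)"
        then show "i2 (bidual_embedding ?J y) g = bidual_embedding X y g"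
          using contractionD(1)[OF i1 g] y by (simp add: i2_def i1_def)
      qed
      then show ?thesis using yh F_f y Jc by (auto simp: i3_def i1_def)
    qed
    have i3F: "i3 F \<in> carrier (dual (dual (dual ?J)))" "vnorm (dual (dual (dual ?J))) (i3 F) \<le> 1"
      using contractionD(1,2)[OF i3 FD(1)] FD(2) by simp_all
    have "vnorm (dual ?J) (i1 f) \<le> vnorm (dual (dual (dual ?J))) (i3 F)"
    proof (rule S.dual_norm_leI[OF DDS.dual_norm_nonneg[OF i3F(1)]])
      fix y assume y: "y \<in> carrier ?J"
      note yh = contractionD(1,2)[OF S.contraction_bidual_embedding y]
      have "norm (i1 f y) \<le> vnorm (dual (dual (dual ?J))) (i3 F) * vnorm (dual (dual ?J)) (bidual_embedding ?J y)"
        using DDS.dual_norm_bound[OF i3F(1) yh(1)] ext y by simp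
      then show "norm (i1 f y) \<le> vnorm (dual (dual (dual ?J))) (i3 F) * vnorm ?J y"
        using mult_left_mono[OF yh(2) DDS.dual_norm_nonneg[OF i3F(1)]] by linarith
    qed
    then show ?thesis using ext i3F i1f_norm by auto
  qed

  \<comment> \<open>Conversely, \<open>F\<close> is determined by its restriction to the bidual of \<open>J\<close>.\<close>
  have F_i3: "F \<phi> = i3 F (dual_adjoint (dual ?J) E \<phi>)"
    if F: "DDX.supports F xh" and \<phi>: "\<phi> \<in> carrier (dual (dual X))" for F \<phi>
  proof -
    have E\<phi>: "dual_adjoint (dual ?J) E \<phi> \<in> carrier (dual (dual ?J))"
      by (rule contractionD(1)[OF contraction_dual_adjoint[OF DS.normed_space_axioms DX.normed_space_axioms E] \<phi>])
    have "i2 (dual_adjoint (dual ?J) E \<phi>) = dual_adjoint (dual X) P \<phi>"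
    proof (rule dual_eqI[of _ "dual X"])
      show "i2 (dual_adjoint (dual ?J) E \<phi>) \<in> carrier (dual (dual X))"
        by (rule contractionD(1)[OF i2 E\<phi>])
      show "dual_adjoint (dual X) P \<phi> \<in> carrier (dual (dual X))"
        by (rule contractionD(1)[OF contraction_dual_adjoint[OF DX.normed_space_axioms DX.normed_space_axioms P_contr] \<phi>])
      fix g assume g: "g \<in> carrier (dual X)"
      then show "i2 (dual_adjoint (dual ?J) E \<phi>) g = dual_adjoint (dual X) P \<phi> g"
        using contractionD(1)[OF i1 g] E_eq by (simp add: i2_def)
    qed
    moreover have "F (dual_adjoint (dual X) P \<phi>) = F \<phi>"
      by (rule X.bidual_support_factors_through_L_projection[OF x(1) _ P a near _ _ _ \<phi>])
        (use F x in \<open>simp_all add: DDX.supports_def xh_def\<close>)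
    ultimately show ?thesis using E\<phi> by (simp add: i3_def)
  qed

  have "\<exists>!F. DDX.supports F xh"
  proof (rule ex_ex1I)
    have fh: "bidual_embedding (dual X) f \<in> carrier (dual (dual (dual X)))"
        "vnorm (dual (dual (dual X))) (bidual_embedding (dual X) f) \<le> 1"
      using contractionD(1,2)[OF DX.contraction_bidual_embedding fD] f1(1) by simp_all
    have "bidual_embedding (dual X) f xh = 1"
      using DX.bidual_embedding_apply[OF xh(1)] fD f1 by (simp add: xh_def)
    then show "\<exists>F. DDX.supports F xh"
      using DDX.supportsI[OF xh fh] by blast
  next
    fix F G assume F: "DDX.supports F xh" and G: "DDX.supports G xh"
    have "i3 F = i3 G"
      using assms(3) i1f i3_eq[OF F] i3_eq[OF G] unfolding Hahn_Banach_smooth_def by blast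
    then have "F \<phi> = G \<phi>" if "\<phi> \<in> carrier (dual (dual X))" for \<phi>
      using F_i3[OF F that] F_i3[OF G that] by simp
    then show "F = G"
      using F G by (intro dual_eqI[of _ "dual (dual X)"]) (simp_all add: DDX.supports_def)
  qed
  then show "very_smooth_point X x"
    using x xh xh_norm
    by (simp add: very_smooth_point_def DDX.smooth_point_iff flip: xh_def)
qed

end
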